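(* Let $n\geq 1$ be an integer, let $\mu$ be a computable, positive $n$-step Bernoulli measure on $2^\omega$, and let $X\in 2^\omega$ be $\mu$-Schnorr random. Then for every non-trivial $n$-block map $\phi:2^{<\omega}\to 2^{<\omega}$ with associated $n$-block functional $\Phi$ (that is, $\Phi$ is a Turing functional whose canonical generator is $\phi$), \[ \mathrm{OI}_\Phi(X)=\mathit{Rate}(\Phi,\mu). \]
   Context: $2^{<\omega}$ is the set of finite binary strings, $2^n$ the set of strings of length $n$, $2^\omega$ the set of infinite binary sequences, $\epsilon$ the empty string, $\preceq$ the prefix relation, $X\upharpoonright m$ the length-$m$ prefix of $X$, $\llbracket\sigma\rrbracket=\{X\in 2^\omega:\sigma\prec X\}$, and $\mu(\sigma)$ abbreviates $\mu(\llbracket\sigma\rrbracket)$. Functionals. A generator is a map $\psi:2^{<\omega}\to 2^{<\omega}$ with $\sigma\preceq\tau\Rightarrow\psi(\sigma)\preceq\psi(\tau)$. The (partial) functional it defines is $\Phi(X)=\bigcup_m\psi(X\upharpoonright m)$, which may be a finite string or an element of $2^\omega$. A Turing functional is one defined by a computable generator. The canonical generator of $\Phi$ sends $\sigma$ to the longest common initial segment of all members of $\{\Phi(X):\sigma\prec X\}$ (finite values $\Phi(X)$ included). Block maps. An $n$-block map is a function $\phi:2^{<\omega}\to2^{<\omega}$ such that whenever $\sigma=\sigma_1{}^\frown\cdots{}^\frown\sigma_k{}^\frown\tau$ with $|\sigma_i|=n$ for all $i$ and $|\tau|<n$, one has $\phi(\sigma)=\phi(\sigma_1)^\frown\cdots^\frown\phi(\sigma_k)$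 (so $\phi(\sigma)=\epsilon$ if $|\sigma|<n$). It is non-trivial if $|\phi(\sigma)|>0$ for some $\sigma\in 2^n$. An $n$-block functional is a Turing functional $\Phi$ whose canonical generator is an $n$-block map $\phi$; then $\phi$ and $\Phi$ are said to be associated. Measures. An $n$-step Bernoulli measure on $2^\omega$ is the measure obtained, via the identification $(2^n)^\omega=2^\omega$, as the infinite product of copies of one fixed probability measure on the finite set $2^n$. A measure $\mu$ is positive if $\mu(\sigma)>0$ for all $\sigma\in 2^{<\omega}$, and computable if the values $\mu(\sigma)$ are uniformly computable reals. $X$ is $\mu$-Schnorr random if $X\notin\bigcap_i\mathcal U_i$ for every uniformly effectively open sequence $(\mathcal U_i)_{i\in\omega}$ with $\mu(\mathcal U_i)\le 2^{-i}$ and $\mu(\mathcal U_i)$ computable uniformly in $i$. Rates. For $\Phi$ with canonical generator $\phi$: $\mathrm{OI}_\Phi(X)=\limsup_{m\to\infty}\frac{|\phi(X\upharpoonright m)|}{m}$; $\mathit{Avg}(\phi,\mu,m)=\frac1m\sum_{\sigma\in 2^m}\mu(\sigma)|\phi(\sigma)|$; $\mathit{Rate}(\Phi,\mu)=\mathit{Rate}(\phi,\mu)=\limsup_{m\to\infty}\mathit{Avg}(\phi,\mu,m)$. *)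

theory Defs
  imports "HOL-Probability.Probability" "HOL-Library.Sublist"
begin

text \<open>Infinite binary sequences are functions \<^typ>\<open>nat \<Rightarrow> bool\<close>, finite strings are
  \<^typ>\<open>bool list\<close>. An element that may be finite or infinite is a partial map
  \<^typ>\<open>nat \<rightharpoonup> bool\<close> defined on an initial segment of the naturals; on such maps the prefix
  relation is \<open>\<subseteq>\<^sub>m\<close>.\<close>

type_synonym functional = "(nat \<Rightarrow> bool) \<Rightarrow> (nat \<rightharpoonup> bool)"

definition init :: "(nat \<Rightarrow> bool) \<Rightarrow> nat \<Rightarrow> bool list" where
  "init X m = map X [0..<m]"

definition cyl :: "bool list \<Rightarrow> (nat \<Rightarrow> bool) set" where
  "cyl \<sigma> = {X. init X (length \<sigma>) = \<sigma>}"

definition str :: "bool list \<Rightarrow> (nat \<rightharpoonup> bool)" where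
  "str \<sigma> = (\<lambda>k. if k < length \<sigma> then Some (\<sigma> ! k) else None)"


subsection \<open>Computability\<close>

text \<open>Total recursive functions of arity \<open>k\<close>: minimisation is applied to regular functions only,
  which by Kleene's normal form theorem yields exactly the total computable functions. Arguments
  are lists; only the values on lists of length \<open>k\<close> are meaningful.\<close>

inductive recursive :: "nat \<Rightarrow> (nat list \<Rightarrow> nat) \<Rightarrow> bool" where
  zero: "recursive k (\<lambda>xs. 0)"
| succ: "recursive 1 (\<lambda>xs. Suc (xs ! 0))"
| proj: "i < k \<Longrightarrow> recursive k (\<lambda>xs. xs ! i)"
| comp: "recursive (length gs) f \<Longrightarrow> (\<And>g. g \<in> set gs \<Longrightarrow> recursive k g) \<Longrightarrow>
    recursive k (\<lambda>xs. f (map (\<lambda>g. g xs) gs))"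
| prim_rec: "recursive k f \<Longrightarrow> recursive (k + 2) g \<Longrightarrow>
    recursive (k + 1) (\<lambda>xs. rec_nat (f (tl xs)) (\<lambda>y r. g (y # r # tl xs)) (hd xs))"
| minim: "recursive (k + 1) f \<Longrightarrow> (\<And>xs. length xs = k \<Longrightarrow> \<exists>y. f (y # xs) = 0) \<Longrightarrow>
    recursive k (\<lambda>xs. LEAST y. f (y # xs) = 0)"

definition ce :: "nat \<Rightarrow> nat list set \<Rightarrow> bool" where
  "ce k W \<longleftrightarrow> (\<exists>f. recursive (k + 1) f \<and>
    (\<forall>xs. length xs = k \<longrightarrow> (xs \<in> W \<longleftrightarrow> (\<exists>s. f (s # xs) = 0))))"

text \<open>The length-lexicographic bijection between finite strings and natural numbers.\<close>

definition code :: "bool list \<Rightarrow> nat" where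
  "code \<sigma> = foldl (\<lambda>c b. 2 * c + 1 + of_bool b) 0 \<sigma>"

definition computable_string_map :: "(bool list \<Rightarrow> bool list) \<Rightarrow> bool" where
  "computable_string_map \<psi> \<longleftrightarrow> (\<exists>f. recursive 1 f \<and> (\<forall>\<sigma>. f [code \<sigma>] = code (\<psi> \<sigma>)))"

text \<open>A family of reals, indexed via the coding \<open>e\<close>, is uniformly computable if rational
  approximations with error at most \<open>2\<^sup>-\<^sup>s\<close> are computable from the index and \<open>s\<close>.\<close>

definition computable_reals :: "('a \<Rightarrow> nat) \<Rightarrow> ('a \<Rightarrow> real) \<Rightarrow> bool" where
  "computable_reals e r \<longleftrightarrow> (\<exists>p q d. recursive 2 p \<and> recursive 2 q \<and> recursive 2 d \<and>
    (\<forall>a s. \<bar>(real (p [e a, s]) - real (q [e a, s])) / real (Suc (d [e a, s])) - r a\<bar> \<le> 1 / 2 ^ s))"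


subsection \<open>Functionals and block maps\<close>

definition generator :: "(bool list \<Rightarrow> bool list) \<Rightarrow> bool" where
  "generator \<psi> \<longleftrightarrow> (\<forall>\<sigma> \<tau>. prefix \<sigma> \<tau> \<longrightarrow> prefix (\<psi> \<sigma>) (\<psi> \<tau>))"

text \<open>The union of the increasing chain of strings \<open>\<psi> (init X m)\<close>; by monotonicity any \<open>m\<close>
  with \<open>k < length (\<psi> (init X m))\<close> yields the same bit at position \<open>k\<close>.\<close>

definition functional_of :: "(bool list \<Rightarrow> bool list) \<Rightarrow> functional" where
  "functional_of \<psi> X = (\<lambda>k. if \<exists>m. k < length (\<psi> (init X m))
     then str (\<psi> (init X (LEAST m. k < length (\<psi> (init X m))))) k else None)"

definition turing_functional :: "functional \<Rightarrow> bool" where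
  "turing_functional \<Phi> \<longleftrightarrow>
    (\<exists>\<psi>. generator \<psi> \<and> computable_string_map \<psi> \<and> \<Phi> = functional_of \<psi>)"

definition common_init_seg :: "functional \<Rightarrow> bool list \<Rightarrow> bool list \<Rightarrow> bool" where
  "common_init_seg \<Phi> \<sigma> \<tau> \<longleftrightarrow> (\<forall>X \<in> cyl \<sigma>. str \<tau> \<subseteq>\<^sub>m \<Phi> X)"

text \<open>A longest common initial segment need not exist as a finite string (if \<open>\<Phi>\<close> is constant on
  \<open>cyl \<sigma>\<close> with an infinite value), so being the canonical generator is stated as a relation.\<close>

definition is_canonical_generator :: "(bool list \<Rightarrow> bool list) \<Rightarrow> functional \<Rightarrow> bool" where
  "is_canonical_generator \<phi> \<Phi> \<longleftrightarrow> (\<forall>\<sigma>. common_init_seg \<Phi> \<sigma> (\<phi> \<sigma>) \<and>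
    (\<forall>\<tau>. common_init_seg \<Phi> \<sigma> \<tau> \<longrightarrow> length \<tau> \<le> length (\<phi> \<sigma>)))"

definition canonical_generator :: "functional \<Rightarrow> bool list \<Rightarrow> bool list" where
  "canonical_generator \<Phi> = (THE \<phi>. is_canonical_generator \<phi> \<Phi>)"

definition block_map :: "nat \<Rightarrow> (bool list \<Rightarrow> bool list) \<Rightarrow> bool" where
  "block_map n \<phi> \<longleftrightarrow> (\<forall>\<sigma>s \<tau>. (\<forall>\<sigma> \<in> set \<sigma>s. length \<sigma> = n) \<and> length \<tau> < n \<longrightarrow>
    \<phi> (concat \<sigma>s @ \<tau>) = concat (map \<phi> \<sigma>s))"

definition nontrivial_block_map :: "nat \<Rightarrow> (bool list \<Rightarrow> bool list) \<Rightarrow> bool" where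
  "nontrivial_block_map n \<phi> \<longleftrightarrow> block_map n \<phi> \<and> (\<exists>\<sigma>. length \<sigma> = n \<and> length (\<phi> \<sigma>) > 0)"

definition associated :: "nat \<Rightarrow> (bool list \<Rightarrow> bool list) \<Rightarrow> functional \<Rightarrow> bool" where
  "associated n \<phi> \<Phi> \<longleftrightarrow>
    block_map n \<phi> \<and> turing_functional \<Phi> \<and> is_canonical_generator \<phi> \<Phi>"


subsection \<open>Measures and randomness\<close>

definition cantor :: "(nat \<Rightarrow> bool) measure" where
  "cantor = Pi\<^sub>M UNIV (\<lambda>_. count_space UNIV)"

definition join_blocks :: "nat \<Rightarrow> (nat \<Rightarrow> bool list) \<Rightarrow> (nat \<Rightarrow> bool)" where
  "join_blocks n B = (\<lambda>k. B (k div n) ! (k mod n))"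

definition bernoulli_measure :: "nat \<Rightarrow> (nat \<Rightarrow> bool) measure \<Rightarrow> bool" where
  "bernoulli_measure n \<mu> \<longleftrightarrow> (\<exists>P. prob_space P \<and> sets P = Pow {\<sigma> :: bool list. length \<sigma> = n} \<and>
    \<mu> = distr (Pi\<^sub>M UNIV (\<lambda>_ :: nat. P)) cantor (join_blocks n))"

definition positive_measure :: "(nat \<Rightarrow> bool) measure \<Rightarrow> bool" where
  "positive_measure \<mu> \<longleftrightarrow> (\<forall>\<sigma>. measure \<mu> (cyl \<sigma>) > 0)"

definition computable_measure :: "(nat \<Rightarrow> bool) measure \<Rightarrow> bool" where
  "computable_measure \<mu> \<longleftrightarrow> computable_reals code (\<lambda>\<sigma>. measure \<mu> (cyl \<sigma>))"

definition uniformly_effectively_open :: "(nat \<Rightarrow> (nat \<Rightarrow> bool) set) \<Rightarrow> bool" where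
  "uniformly_effectively_open U \<longleftrightarrow>
    (\<exists>W. ce 2 W \<and> (\<forall>i. U i = \<Union> {cyl \<sigma> | \<sigma>. [i, code \<sigma>] \<in> W}))"

definition schnorr_test :: "(nat \<Rightarrow> bool) measure \<Rightarrow> (nat \<Rightarrow> (nat \<Rightarrow> bool) set) \<Rightarrow> bool" where
  "schnorr_test \<mu> U \<longleftrightarrow> uniformly_effectively_open U \<and>
    (\<forall>i. measure \<mu> (U i) \<le> 1 / 2 ^ i) \<and> computable_reals (\<lambda>i. i) (\<lambda>i. measure \<mu> (U i))"

definition schnorr_random :: "(nat \<Rightarrow> bool) measure \<Rightarrow> (nat \<Rightarrow> bool) \<Rightarrow> bool" where
  "schnorr_random \<mu> X \<longleftrightarrow> (\<forall>U. schnorr_test \<mu> U \<longrightarrow> X \<notin> (\<Inter>i. U i))"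


subsection \<open>Rates\<close>

definition OI :: "functional \<Rightarrow> (nat \<Rightarrow> bool) \<Rightarrow> ereal" where
  "OI \<Phi> X = limsup (\<lambda>m. ereal (real (length (canonical_generator \<Phi> (init X m))) / real m))"

definition Avg :: "(bool list \<Rightarrow> bool list) \<Rightarrow> (nat \<Rightarrow> bool) measure \<Rightarrow> nat \<Rightarrow> real" where
  "Avg \<phi> \<mu> m = 1 / real m * (\<Sum>\<sigma> | length \<sigma> = m. measure \<mu> (cyl \<sigma>) * real (length (\<phi> \<sigma>)))"

definition Rate :: "functional \<Rightarrow> (nat \<Rightarrow> bool) measure \<Rightarrow> ereal" where
  "Rate \<Phi> \<mu> = limsup (\<lambda>m. ereal (Avg (canonical_generator \<Phi>) \<mu> m))"


subsection \<open>Well-definedness\<close>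

lemma functional_of_eq_Some_iff:
  assumes "generator \<psi>"
  shows "functional_of \<psi> X k = Some b \<longleftrightarrow> (\<exists>m. str (\<psi> (init X m)) k = Some b)"
proof -
  have mono: "prefix (\<psi> (init X m)) (\<psi> (init X m'))" if "m \<le> m'" for m m'
  proof -
    have "init X m' = init X m @ map X [m..<m']"
      using upt_add_eq_append[of 0 m "m' - m"] that by (simp add: init_def)
    thus ?thesis using assms by (simp add: generator_def)
  qed
  have agree: "\<psi> (init X m) ! k = \<psi> (init X m') ! k"
    if "k < length (\<psi> (init X m))" "k < length (\<psi> (init X m'))" for m m'
  proof (cases "m \<le> m'")
    case True
    from mono[OF this] show ?thesis using that(1) by (auto elim!: prefixE simp: nth_append)
  next
    case False
    hence "prefix (\<psi> (init X m')) (\<psi> (init X m))" by (intro mono) simp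
    thus ?thesis using that(2) by (auto elim!: prefixE simp: nth_append)
  qed
  show ?thesis
  proof (cases "\<exists>m. k < length (\<psi> (init X m))")
    case True
    define l where "l = (LEAST m. k < length (\<psi> (init X m)))"
    have l: "k < length (\<psi> (init X l))"
      unfolding l_def using True by (rule LeastI_ex)
    have "functional_of \<psi> X k = Some (\<psi> (init X l) ! k)"
      using True l by (simp add: functional_of_def str_def l_def)
    moreover have "str (\<psi> (init X l)) k = Some (\<psi> (init X l) ! k)"
      using l by (simp add: str_def)
    moreover have "\<psi> (init X l) ! k = b" if "str (\<psi> (init X m)) k = Some b" for m
      using that agree[OF l, of m] by (auto simp: str_def split: if_splits)
    ultimately show ?thesis by auto
  qed (auto simp: functional_of_def str_def)
qed

lemma is_canonical_generator_unique:
  assumes "is_canonical_generator \<phi> \<Phi>" "is_canonical_generator \<phi>' \<Phi>"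
  shows "\<phi> = \<phi>'"
proof
  fix \<sigma>
  define X where "X = (\<lambda>k. if k < length \<sigma> then \<sigma> ! k else False)"
  have X: "X \<in> cyl \<sigma>"
    by (auto simp: cyl_def init_def X_def intro!: nth_equalityI)
  have len: "length (\<phi> \<sigma>) = length (\<phi>' \<sigma>)"
    using assms by (meson is_canonical_generator_def le_antisym)
  have le: "str (\<phi> \<sigma>) \<subseteq>\<^sub>m \<Phi> X" "str (\<phi>' \<sigma>) \<subseteq>\<^sub>m \<Phi> X"
    using assms X by (auto simp: is_canonical_generator_def common_init_seg_def)
  show "\<phi> \<sigma> = \<phi>' \<sigma>"
  proof (rule nth_equalityI[OF len])
    fix k assume k: "k < length (\<phi> \<sigma>)"
    have at: "\<Phi> X k = Some (\<tau> ! k)" if "str \<tau> \<subseteq>\<^sub>m \<Phi> X" "k < length \<tau>" for \<tau>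
      using bspec[OF that(1)[unfolded map_le_def], of k] that(2) by (simp add: str_def dom_def)
    have "Some (\<phi> \<sigma> ! k) = Some (\<phi>' \<sigma> ! k)"
      using at[OF le(1)] at[OF le(2)] k len by simp
    thus "\<phi> \<sigma> ! k = \<phi>' \<sigma> ! k" by simp
  qed
qed

lemma canonical_generator_eq: "is_canonical_generator \<phi> \<Phi> \<Longrightarrow> canonical_generator \<Phi> = \<phi>"
  unfolding canonical_generator_def by (blast intro: is_canonical_generator_unique)

lemma measurable_join_blocks:
  assumes "sets P = Pow {\<sigma> :: bool list. length \<sigma> = n}"
  shows "join_blocks n \<in> measurable (Pi\<^sub>M UNIV (\<lambda>_ :: nat. P)) cantor"
proof -
  have *: "(\<lambda>B. B (k div n) ! (k mod n)) \<in> measurable (Pi\<^sub>M UNIV (\<lambda>_ :: nat. P)) (count_space UNIV)"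
    for k
  proof (rule measurable_compose[OF measurable_component_singleton])
    have "space P = {\<sigma>. length \<sigma> = n}"
      using sets_eq_imp_space_eq[of P "count_space {\<sigma>. length \<sigma> = n}"] assms by simp
    thus "(\<lambda>\<sigma>. \<sigma> ! (k mod n)) \<in> measurable P (count_space UNIV)"
      using assms by (auto simp: measurable_def)
  qed simp
  show ?thesis
    unfolding cantor_def join_blocks_def
    by (rule measurable_PiM_single') (use * in auto)
qed

end

theory Submission imports Defs begin

text \<open>
  A block map sends the prefix of \<open>X\<close> of length \<open>m\<close> to the concatenation of the images of its
  first \<open>m div n\<close> blocks. With \<open>g \<sigma>\<close> the length of the image of a single block \<open>\<sigma>\<close>, the output
  after \<open>m\<close> bits thus has length \<open>g B\<^sub>0 + \<dots> + g B\<^sub>k\<^sub>-\<^sub>1\<close> where \<open>k = m div n\<close> and \<open>B\<^sub>j\<close> is the \<open>j\<close>-th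
  block of \<open>X\<close>. Under \<open>\<mu>\<close> the blocks are independent with common distribution \<open>P\<close>, so the average
  output length is exactly \<open>k\<close> times the mean \<open>E\<close> of \<open>g\<close> under \<open>P\<close>, and the rate is \<open>E / n\<close>.
  The theorem therefore amounts to the strong law of large numbers for block sums at every Schnorr
  random sequence (\<open>schnorr_block_law_of_large_numbers\<close>).

  That law has an effective proof. If the average of \<open>g\<close> over the first \<open>k\<close> blocks exceeds \<open>E + \<epsilon>\<close>
  for infinitely many \<open>k\<close>, then it exceeds some fixed rational \<open>q > E\<close> for infinitely many \<open>k\<close>.
  Whether it does so for a given \<open>k\<close> depends on finitely many bits and is decidable, because \<open>q\<close> is
  a rational constant and \<open>g\<close> matters only on the finitely many strings of length \<open>n\<close>. By Hoeffding's inequality the probability of such a deviation decays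
  exponentially in \<open>k\<close>. The deviations late enough in the sequence thus form an effectively
  open set of measure at most \<open>2\<^sup>-\<^sup>i\<close>, whose measure is computable because it is approximated, with an
  explicit error, by the clopen set of deviations before a later time. This is a Schnorr
  test (\<open>schnorr_borel_cantelli\<close>). Deviations below \<open>E\<close> are deviations above the mean for
  \<open>M - g\<close>, where \<open>M\<close> bounds \<open>g\<close>.
\<close>

section \<open>Closure properties of the recursive functions\<close>

text \<open>The values of a recursive function of arity \<open>k\<close> on lists of other lengths are artefacts of
  its construction. Working up to agreement on lists of length \<open>k\<close> makes the class extensional,
  so that functions can be rewritten freely.\<close>

definition computable :: "nat \<Rightarrow> (nat list \<Rightarrow> nat) \<Rightarrow> bool" where
  "computable k f \<longleftrightarrow> (\<exists>g. recursive k g \<and> (\<forall>xs. length xs = k \<longrightarrow> g xs = f xs))"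

definition decidable :: "nat \<Rightarrow> (nat list \<Rightarrow> bool) \<Rightarrow> bool" where
  "decidable k Q \<longleftrightarrow> computable k (\<lambda>xs. of_bool (Q xs))"

lemma computable_cong: "computable k f \<Longrightarrow> (\<And>xs. length xs = k \<Longrightarrow> f xs = g xs) \<Longrightarrow> computable k g"
  unfolding computable_def by metis

lemma computable_nth: "i < k \<Longrightarrow> computable k (\<lambda>xs. xs ! i)"
  unfolding computable_def using recursive.proj by blast

lemma computable_comp:
  assumes "computable (length gs) f" "\<And>g. g \<in> set gs \<Longrightarrow> computable k g"
  shows "computable k (\<lambda>xs. f (map (\<lambda>g. g xs) gs))"
proof -
  obtain f' where f': "recursive (length gs) f'" "\<And>xs. length xs = length gs \<Longrightarrow> f' xs = f xs"
    using assms(1) unfolding computable_def by blast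
  obtain r where r: "\<And>g. g \<in> set gs \<Longrightarrow> recursive k (r g)"
    "\<And>g xs. g \<in> set gs \<Longrightarrow> length xs = k \<Longrightarrow> r g xs = g xs"
    using assms(2) unfolding computable_def by metis
  have "recursive k (\<lambda>xs. f' (map (\<lambda>g. g xs) (map r gs)))"
    by (rule recursive.comp) (use f' r in auto)
  moreover have "f' (map (\<lambda>g. g xs) (map r gs)) = f (map (\<lambda>g. g xs) gs)" if "length xs = k" for xs
  proof -
    have "map (\<lambda>g. g xs) (map r gs) = map (\<lambda>g. g xs) gs"
      using r(2)[OF _ that] by simp
    thus ?thesis using f'(2)[of "map (\<lambda>g. g xs) gs"] by (simp del: map_map)
  qed
  ultimately show ?thesis unfolding computable_def by blast
qed

lemma computable_comp1:
  assumes "computable 1 (\<lambda>xs. f (xs ! 0))" "computable k g"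
  shows "computable k (\<lambda>xs. f (g xs))"
  using computable_comp[of "[g]" "\<lambda>xs. f (xs ! 0)" k] assms by simp

lemma computable_comp2:
  assumes "computable 2 (\<lambda>xs. f (xs ! 0) (xs ! 1))" "computable k g" "computable k h"
  shows "computable k (\<lambda>xs. f (g xs) (h xs))"
  using computable_comp[of "[g, h]" "\<lambda>xs. f (xs ! 0) (xs ! 1)" k] assms by (auto simp: numeral_2_eq_2)

lemma computable_Suc: "computable k f \<Longrightarrow> computable k (\<lambda>xs. Suc (f xs))"
proof (rule computable_comp1[where f = Suc])
  show "computable 1 (\<lambda>xs. Suc (xs ! 0))" unfolding computable_def using recursive.succ by blast
qed

lemma computable_const: "computable k (\<lambda>xs. c)"
  by (induction c) (auto simp: computable_def[of _ "\<lambda>_. 0"] intro: recursive.zero computable_Suc)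

text \<open>Primitive recursion on an arbitrary bound, with the parameters \<open>xs\<close> available to the step
  function. Every arithmetic operation below is obtained from this form.\<close>

lemma computable_rec:
  assumes "computable k f" "computable (k + 2) (\<lambda>zs. g (zs ! 0) (zs ! 1) (drop 2 zs))" "computable k b"
  shows "computable k (\<lambda>xs. rec_nat (f xs) (\<lambda>y r. g y r xs) (b xs))"
proof -
  obtain f' where f': "recursive k f'" "\<And>xs. length xs = k \<Longrightarrow> f' xs = f xs"
    using assms(1) unfolding computable_def by blast
  obtain g' where g': "recursive (k + 2) g'"
    "\<And>zs. length zs = k + 2 \<Longrightarrow> g' zs = g (zs ! 0) (zs ! 1) (drop 2 zs)"
    using assms(2) unfolding computable_def by blast
  define R where "R = (\<lambda>ys. rec_nat (f' (tl ys)) (\<lambda>y r. g' (y # r # tl ys)) (hd ys))"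
  have "recursive (k + 1) R"
    unfolding R_def by (rule recursive.prim_rec[OF f'(1) g'(1)])
  hence "computable (k + 1) R" unfolding computable_def by blast
  hence "computable k (\<lambda>xs. R (map (\<lambda>g. g xs) (b # map (\<lambda>i xs. xs ! i) [0..<k])))"
    by (intro computable_comp) (use assms(3) in \<open>auto intro: computable_nth\<close>)
  thus ?thesis
  proof (rule computable_cong)
    fix xs :: "nat list" assume l: "length xs = k"
    have m: "map ((\<lambda>g. g xs) \<circ> (\<lambda>i xs. xs ! i)) [0..<k] = xs"
      using l by (auto intro!: nth_equalityI)
    have "rec_nat (f' xs) (\<lambda>y r. g' (y # r # xs)) c = rec_nat (f xs) (\<lambda>y r. g y r xs) c" for c
      by (induction c) (simp_all add: f'(2) g'(2) l)
    thus "R (map (\<lambda>g. g xs) (b # map (\<lambda>i xs. xs ! i) [0..<k]))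
        = rec_nat (f xs) (\<lambda>y r. g y r xs) (b xs)"
      by (simp add: R_def m)
  qed
qed

lemma computable_add:
  assumes "computable k f" "computable k g"
  shows "computable k (\<lambda>xs. f xs + g xs)"
proof -
  have "computable k (\<lambda>xs. rec_nat (f xs) (\<lambda>y r. Suc r) (g xs))"
    by (rule computable_rec) (auto intro: assms computable_Suc computable_nth)
  moreover have "rec_nat a (\<lambda>y r. Suc r) b = a + b" for a b :: nat
    by (induction b) auto
  ultimately show ?thesis by simp
qed

lemma computable_diff:
  assumes "computable k f" "computable k g"
  shows "computable k (\<lambda>xs. f xs - g xs)"
proof -
  have pred: "computable k (\<lambda>xs. h xs - 1)" if "computable k h" for k h
  proof -
    have "computable k (\<lambda>xs. rec_nat 0 (\<lambda>y r. y) (h xs))"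
      by (rule computable_rec) (auto intro: that computable_const computable_nth)
    moreover have "rec_nat 0 (\<lambda>y r. y) b = b - 1" for b :: nat
      by (cases b) auto
    ultimately show ?thesis by simp
  qed
  have "computable k (\<lambda>xs. rec_nat (f xs) (\<lambda>y r. r - 1) (g xs))"
    by (rule computable_rec) (auto intro: assms pred[simplified] computable_nth)
  moreover have "rec_nat a (\<lambda>y r. r - 1) b = a - b" for a b :: nat
    by (induction b) auto
  ultimately show ?thesis by simp
qed

lemma computable_mult:
  assumes "computable k f" "computable k g"
  shows "computable k (\<lambda>xs. f xs * g xs)"
proof -
  have *: "computable 2 (\<lambda>xs. rec_nat 0 (\<lambda>y r. r + xs ! 0) (xs ! 1))"
  proof (rule computable_rec)
    have "computable (2 + 2) (\<lambda>zs. zs ! 1 + zs ! 2)"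
      by (intro computable_add computable_nth) auto
    thus "computable (2 + 2) (\<lambda>zs. zs ! 1 + drop 2 zs ! 0)"
      by (rule computable_cong) simp
  qed (auto intro: computable_nth computable_const)
  have "rec_nat 0 (\<lambda>y r. r + a) b = a * b" for a b :: nat
    by (induction b) auto
  hence "computable 2 (\<lambda>xs. (xs ! 0) * (xs ! 1))" using * by simp
  from computable_comp2[OF this assms] show ?thesis .
qed

lemma computable_pow2:
  assumes "computable k g"
  shows "computable k (\<lambda>xs. 2 ^ g xs)"
proof -
  have "computable k (\<lambda>xs. rec_nat 1 (\<lambda>y r. r + r) (g xs))"
    by (rule computable_rec) (auto intro: assms computable_add computable_const computable_nth)
  moreover have "rec_nat 1 (\<lambda>y r. r + r) b = (2 :: nat) ^ b" for b
    by (induction b) auto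
  ultimately show ?thesis by simp
qed

text \<open>Bounded sums stand in for bounded search: quantifiers, quotients and case distinctions
  are all counted by sums of truth values. In the summand the bound variable is the head of the
  argument list, which lets the closure rules be applied mechanically through nested sums.\<close>

lemma computable_sum:
  assumes "computable (k + 1) (\<lambda>ys. F (hd ys) (tl ys))" "computable k b"
  shows "computable k (\<lambda>xs. \<Sum>y<b xs. F y xs)"
proof -
  have "computable k (\<lambda>xs. rec_nat 0 (\<lambda>y r. r + F y xs) (b xs))"
  proof (rule computable_rec)
    define gs :: "(nat list \<Rightarrow> nat) list" where
      "gs = (\<lambda>zs. zs ! 0) # map (\<lambda>i zs. zs ! (i + 2)) [0..<k]"
    have "computable (k + 2) (\<lambda>zs. F (hd (map (\<lambda>g. g zs) gs)) (tl (map (\<lambda>g. g zs) gs)))"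
      by (rule computable_comp[where f = "\<lambda>ys. F (hd ys) (tl ys)"])
         (use assms(1) in \<open>auto simp: gs_def intro: computable_nth[of "_ + 2", simplified] computable_nth\<close>)
    hence "computable (k + 2) (\<lambda>zs. zs ! 1 + F (hd (map (\<lambda>g. g zs) gs)) (tl (map (\<lambda>g. g zs) gs)))"
      by (intro computable_add computable_nth) auto
    thus "computable (k + 2) (\<lambda>zs. zs ! 1 + F (zs ! 0) (drop 2 zs))"
    proof (rule computable_cong)
      fix zs :: "nat list" assume "length zs = k + 2"
      hence "map ((\<lambda>g. g zs) \<circ> (\<lambda>i zs. zs ! Suc (Suc i))) [0..<k] = drop 2 zs"
        by (auto intro!: nth_equalityI)
      thus "zs ! 1 + F (hd (map (\<lambda>g. g zs) gs)) (tl (map (\<lambda>g. g zs) gs))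
          = zs ! 1 + F (zs ! 0) (drop 2 zs)"
        by (simp add: gs_def)
    qed
  qed (auto intro: assms computable_const)
  moreover have "rec_nat 0 (\<lambda>y r. r + F y xs) c = (\<Sum>y<c. F y xs)" for c xs
    by (induction c) auto
  ultimately show ?thesis by simp
qed

lemma decidable_less:
  assumes "computable k f" "computable k g"
  shows "decidable k (\<lambda>xs. f xs < g xs)"
proof -
  have "computable k (\<lambda>xs. 1 - (1 - (g xs - f xs)))"
    by (intro computable_diff computable_const assms)
  thus ?thesis unfolding decidable_def by (rule computable_cong) auto
qed

lemma decidable_not: "decidable k Q \<Longrightarrow> decidable k (\<lambda>xs. \<not> Q xs)"
  unfolding decidable_def
  by (rule computable_cong[of k "\<lambda>xs. 1 - of_bool (Q xs)"]) (auto intro: computable_diff computable_const)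

lemma decidable_and: "decidable k Q \<Longrightarrow> decidable k R \<Longrightarrow> decidable k (\<lambda>xs. Q xs \<and> R xs)"
  unfolding decidable_def
  by (rule computable_cong[of k "\<lambda>xs. of_bool (Q xs) * of_bool (R xs)"]) (auto intro: computable_mult)

lemma decidable_le:
  assumes "computable k f" "computable k g"
  shows "decidable k (\<lambda>xs. f xs \<le> g xs)"
  using decidable_not[OF decidable_less[OF assms(2,1)]] by (simp add: not_less)

lemma decidable_eq:
  assumes "computable k f" "computable k g"
  shows "decidable k (\<lambda>xs. f xs = g xs)"
  using decidable_and[OF decidable_le[OF assms] decidable_le[OF assms(2,1)]] by (simp add: eq_iff)

lemma decidable_bex:
  assumes "decidable (k + 1) (\<lambda>ys. Q (hd ys) (tl ys))" "computable k b"
  shows "decidable k (\<lambda>xs. \<exists>y<b xs. Q y xs)"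
proof -
  have "decidable k (\<lambda>xs. 0 < (\<Sum>y<b xs. of_bool (Q y xs) :: nat))"
    by (intro decidable_less computable_const computable_sum)
       (use assms in \<open>auto simp: decidable_def\<close>)
  moreover have "(0 < (\<Sum>y<c. of_bool (Q y xs) :: nat)) \<longleftrightarrow> (\<exists>y<c. Q y xs)" for c xs
    by (induction c) (auto simp: less_Suc_eq)
  ultimately show ?thesis by simp
qed

lemma computable_hd: "0 < k \<Longrightarrow> computable k hd"
  by (rule computable_cong[OF computable_nth[of 0]]) (auto simp: hd_conv_nth)

lemma computable_tl:
  assumes "computable k f"
  shows "computable (k + 1) (\<lambda>ys. f (tl ys))"
proof -
  have "computable (k + 1) (\<lambda>ys. f (map (\<lambda>g. g ys) (map (\<lambda>i ys. ys ! Suc i) [0..<k])))"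
    by (rule computable_comp) (use assms in \<open>auto intro: computable_nth\<close>)
  thus ?thesis
  proof (rule computable_cong)
    fix ys :: "nat list" assume "length ys = k + 1"
    hence "map ((\<lambda>g. g ys) \<circ> (\<lambda>i ys. ys ! Suc i)) [0..<k] = tl ys"
      by (auto intro!: nth_equalityI simp: nth_tl)
    thus "f (map (\<lambda>g. g ys) (map (\<lambda>i ys. ys ! Suc i) [0..<k])) = f (tl ys)" by simp
  qed
qed

text \<open>The quotient of \<open>a\<close> by \<open>b\<close> is the number of positive multiples of \<open>b\<close> that are at most \<open>a\<close>,
  each being the multiple by some factor at most \<open>a\<close>.\<close>

lemma computable_div:
  assumes "computable k f" "computable k g" "\<And>xs. 0 < g xs"
  shows "computable k (\<lambda>xs. f xs div g xs)"
proof -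
  have "computable k (\<lambda>xs. \<Sum>z<f xs. of_bool (Suc z * g xs \<le> f xs))"
    by (intro computable_sum assms decidable_le[unfolded decidable_def] computable_mult computable_Suc computable_hd computable_tl) simp
  moreover have "(\<Sum>z<a. of_bool (Suc z * b \<le> a)) = a div b" if "0 < b" for a b :: nat
  proof -
    have "Suc z * b \<le> a \<longleftrightarrow> z < a div b" for z
      using less_eq_div_iff_mult_less_eq[OF that, of "Suc z" a] by (simp add: Suc_le_eq)
    hence "{..<a} \<inter> {z. Suc z * b \<le> a} = {..<a div b}"
      using div_le_dividend[of a b] by (auto simp del: mult_Suc intro: less_le_trans)
    thus ?thesis by (simp add: sum_of_bool_eq)
  qed
  ultimately show ?thesis by (simp add: assms(3))
qed

lemma computable_mod:
  assumes "computable k f" "computable k g" "\<And>xs. 0 < g xs"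
  shows "computable k (\<lambda>xs. f xs mod g xs)"
proof -
  have "computable k (\<lambda>xs. f xs - f xs div g xs * g xs)"
    by (intro computable_diff computable_mult computable_div assms)
  thus ?thesis by (simp add: minus_div_mult_eq_mod)
qed

text \<open>An arbitrary function is computable on a bounded range, by listing its values. This is
  how an arbitrary weight on the blocks of a fixed length enters a computation.\<close>

lemma computable_finite_table:
  assumes "computable k f" "\<And>xs. f xs < M"
  shows "computable k (\<lambda>xs. G (f xs))"
proof -
  have "computable k (\<lambda>xs. if f xs < m then G (f xs) else 0)" for m
  proof (induction m)
    case (Suc m)
    have "computable k (\<lambda>xs. (if f xs < m then G (f xs) else 0) + of_bool (f xs = m) * G m)"
      by (intro computable_add computable_mult computable_const Suc
          decidable_eq[unfolded decidable_def] assms)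
    moreover have "(if f xs < m then G (f xs) else 0) + of_bool (f xs = m) * G m
        = (if f xs < Suc m then G (f xs) else 0)" for xs
      by (cases "f xs = m") (simp_all add: less_Suc_eq)
    ultimately show ?case by simp
  qed (simp add: computable_const)
  from this[of M] show ?thesis by (simp add: assms(2))
qed

text \<open>A decision procedure, read as a semidecision procedure that ignores its search
  variable, yields enumerability.\<close>

lemma ce_decidable: "decidable k (\<lambda>xs. xs \<in> W) \<Longrightarrow> ce k W"
proof -
  assume "decidable k (\<lambda>xs. xs \<in> W)"
  hence "computable (k + 1) (\<lambda>ys. 1 - of_bool (tl ys \<in> W))"
    unfolding decidable_def by (intro computable_diff computable_const computable_tl)
  then obtain g where g: "recursive (k + 1) g"
    "\<And>ys. length ys = k + 1 \<Longrightarrow> g ys = 1 - of_bool (tl ys \<in> W)"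
    unfolding computable_def by blast
  show "ce k W"
    unfolding ce_def using g by (intro exI[of _ g]) auto
qed

section \<open>Binary strings as numbers\<close>

text \<open>In length-lexicographic order, \<open>code \<sigma> + 1\<close> is the number with binary expansion \<open>1\<sigma>\<close>.
  The leading one records the length; prefixes and digits are obtained by division by powers of two.\<close>

definition val :: "bool list \<Rightarrow> nat" where
  "val \<sigma> = code \<sigma> + 1"

lemma val_Nil [simp]: "val [] = 1"
  by (simp add: val_def code_def)

lemma val_snoc: "val (\<sigma> @ [b]) = 2 * val \<sigma> + of_bool b"
  by (simp add: val_def code_def)

lemma code_eq_val: "code \<sigma> = val \<sigma> - 1"
  by (simp add: val_def)

lemma val_bounds: "2 ^ length \<sigma> \<le> val \<sigma>" "val \<sigma> < 2 ^ (length \<sigma> + 1)"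
  by (induction \<sigma> rule: rev_induct) (auto simp: val_snoc)

lemma val_append: "val (\<sigma> @ \<tau>) = val \<sigma> * 2 ^ length \<tau> + (val \<tau> - 2 ^ length \<tau>)"
proof (induction \<tau> rule: rev_induct)
  case (snoc b \<tau>)
  show ?case
    using val_bounds(1)[of \<tau>] 
    by (simp add: val_snoc snoc append_assoc[symmetric] algebra_simps diff_mult_distrib del: append_assoc)
qed simp

lemma val_append_div: "val (\<sigma> @ \<tau>) div 2 ^ length \<tau> = val \<sigma>"
proof -
  have "val \<tau> - 2 ^ length \<tau> < 2 ^ length \<tau>"
    using val_bounds[of \<tau>] by simp
  thus ?thesis by (simp add: val_append)
qed

text \<open>Dropping the last \<open>j\<close> bits is division by \<open>2\<^sup>j\<close>, so that quantification over the
  prefixes of a string becomes a bounded quantification over \<open>j\<close>.\<close>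

lemma val_take: "j \<le> length \<sigma> \<Longrightarrow> val \<sigma> div 2 ^ j = val (take (length \<sigma> - j) \<sigma>)"
  using val_append_div[of "take (length \<sigma> - j) \<sigma>" "drop (length \<sigma> - j) \<sigma>"] by simp

text \<open>Lengths of strings can be compared with a bound without computing a logarithm.\<close>

lemma le_val_iff: "2 ^ m \<le> val \<sigma> \<longleftrightarrow> m \<le> length \<sigma>"
proof
  assume "2 ^ m \<le> val \<sigma>"
  hence "(2 :: nat) ^ m < 2 ^ (length \<sigma> + 1)"
    using val_bounds(2)[of \<sigma>] by linarith
  hence "m < length \<sigma> + 1"
    by (rule power_less_imp_less_exp[rotated]) simp
  thus "m \<le> length \<sigma>" by simp
next
  assume "m \<le> length \<sigma>"
  hence "(2 :: nat) ^ m \<le> 2 ^ length \<sigma>" by (intro power_increasing) auto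
  thus "2 ^ m \<le> val \<sigma>" using val_bounds(1)[of \<sigma>] by linarith
qed

lemma inj_val: "inj val"
proof (rule injI)
  fix \<sigma> \<tau> assume "val \<sigma> = val \<tau>"
  thus "\<sigma> = \<tau>"
  proof (induction \<sigma> arbitrary: \<tau> rule: rev_induct)
    case Nil
    thus ?case using le_val_iff[of 1 \<tau>] by (simp add: Suc_le_eq flip: Nil)
  next
    case (snoc b \<sigma>)
    have "1 \<le> length \<tau>"
      using le_val_iff[of 1 \<tau>] le_val_iff[of 1 "\<sigma> @ [b]"] snoc.prems by simp
    then obtain \<tau>' b' where \<tau>: "\<tau> = \<tau>' @ [b']"
      by (cases \<tau> rule: rev_cases) auto
    have "val \<sigma> = val \<tau>' \<and> b = b'"
      using snoc.prems by (cases b; cases b') (auto simp: \<tau> val_snoc, presburger+)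
    thus ?case using snoc.IH \<tau> by blast
  qed
qed

lemma bij_betw_val: "bij_betw val {\<sigma>. length \<sigma> = N} {2 ^ N..<2 ^ (N + 1)}"
proof -
  have sub: "val ` {\<sigma>. length \<sigma> = N} \<subseteq> {2 ^ N..<2 ^ (N + 1)}"
    using val_bounds by (fastforce simp del: power_Suc)
  have "card (val ` {\<sigma>. length \<sigma> = N}) = 2 ^ N"
    using card_lists_length_eq[of "UNIV :: bool set" N] inj_on_subset[OF inj_val]
    by (subst card_image) auto
  hence "val ` {\<sigma>. length \<sigma> = N} = {2 ^ N..<2 ^ (N + 1)}"
    by (intro card_subset_eq sub) auto
  thus ?thesis unfolding bij_betw_def using inj_on_subset[OF inj_val] by auto
qed

text \<open>The strings of length \<open>N\<close> occupy exactly the numbers from \<open>2\<^sup>N\<close> to \<open>2\<^sup>N\<^sup>+\<^sup>1 - 1\<close>. This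
  turns a sum over all strings of a given length into a bounded sum of numbers.\<close>

lemma sum_strings_val:
  "(\<Sum>\<sigma> | length \<sigma> = N. f (val \<sigma>)) = (\<Sum>v<2 ^ N. f (2 ^ N + v))" for f :: "nat \<Rightarrow> 'a :: comm_monoid_add"
proof -
  have "(\<Sum>\<sigma> | length \<sigma> = N. f (val \<sigma>)) = (\<Sum>u = 2 ^ N..<2 ^ (N + 1). f u)"
    by (rule sum.reindex_bij_betw[OF bij_betw_val])
  also have "\<dots> = (\<Sum>v<2 ^ N. f (2 ^ N + v))"
    using sum.atLeastLessThan_shift_0[of f "2 ^ N" "2 ^ (N + 1)"] by (simp add: lessThan_atLeast0)
  finally show ?thesis .
qed

lemma finite_strings: "finite {\<sigma> :: bool list. length \<sigma> = N}"
  using finite_lists_length_eq[of "UNIV :: bool set" N] by simp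

section \<open>Cylinders and their measures\<close>

lemma length_init [simp]: "length (init X m) = m"
  by (simp add: init_def)

lemma nth_init [simp]: "k < m \<Longrightarrow> init X m ! k = X k"
  by (simp add: init_def)

lemma take_init [simp]: "take k (init X m) = init X (min k m)"
  by (auto simp: init_def take_map min_def)

lemma mem_cyl: "X \<in> cyl \<sigma> \<longleftrightarrow> (\<forall>k<length \<sigma>. X k = \<sigma> ! k)"
  by (auto simp: cyl_def list_eq_iff_nth_eq)

lemma space_cantor [simp]: "space cantor = UNIV"
  by (simp add: cantor_def space_PiM)

lemma cyl_sets [measurable]: "cyl \<sigma> \<in> sets cantor"
proof -
  have *: "{X \<in> space cantor. X k = b} \<in> sets cantor" for k b
  proof -
    have "(\<lambda>X. X k) -` {b} \<inter> space cantor \<in> sets cantor"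
      by (rule measurable_sets[of _ _ "count_space UNIV"]) (simp_all add: cantor_def)
    thus ?thesis by (simp add: vimage_def)
  qed
  have "{X \<in> space cantor. \<forall>k\<in>{..<length \<sigma>}. X k = \<sigma> ! k} \<in> sets cantor"
    by (rule sets.sets_Collect_finite_All[OF *]) simp
  moreover have "{X \<in> space cantor. \<forall>k\<in>{..<length \<sigma>}. X k = \<sigma> ! k} = cyl \<sigma>"
    by (auto simp: mem_cyl)
  ultimately show ?thesis by simp
qed

lemma Union_cyl_sets: "(\<Union>\<sigma>\<in>S. cyl \<sigma>) \<in> sets cantor"
  by (intro sets.countable_UN') auto

lemma measure_Union_cyl:
  assumes "prob_space \<mu>" "sets \<mu> = sets cantor" "S \<subseteq> {\<sigma>. length \<sigma> = N}"
  shows "measure \<mu> (\<Union>\<sigma>\<in>S. cyl \<sigma>) = (\<Sum>\<sigma>\<in>S. measure \<mu> (cyl \<sigma>))"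
proof -
  interpret prob_space \<mu> by fact
  show ?thesis
  proof (rule finite_measure_finite_Union)
    show "finite S" using assms(3) finite_strings finite_subset by blast
    show "disjoint_family_on cyl S"
      unfolding disjoint_family_on_def
    proof (intro ballI impI)
      fix \<sigma> \<tau> assume *: "\<sigma> \<in> S" "\<tau> \<in> S" "\<sigma> \<noteq> \<tau>"
      hence len: "length \<sigma> = length \<tau>" using assms(3) by blast
      have "\<sigma> = \<tau>" if "X \<in> cyl \<sigma>" "X \<in> cyl \<tau>" for X
        using that unfolding cyl_def mem_Collect_eq len by simp
      thus "cyl \<sigma> \<inter> cyl \<tau> = {}" using *(3) by blast
    qed
    show "cyl ` S \<subseteq> events" using cyl_sets assms(2) by blast
  qed
qed


section \<open>An effective Borel--Cantelli lemma for Schnorr randomness\<close>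

text \<open>Approximations by fractions with unrelated denominators are rounded down to a common
  dyadic denominator, so that many of them can be added as integers. Rounding at most doubles
  the error bound, and for nonnegative reals truncating negative numerators to zero does no harm.\<close>

lemma computable_reals_dyadic:
  assumes "computable_reals e r" "\<And>a. 0 \<le> r a"
  obtains P where "computable 2 (\<lambda>xs. P (xs ! 0) (xs ! 1))"
    "\<And>a t. \<bar>real (P (e a) t) / 2 ^ t - r a\<bar> \<le> 2 / 2 ^ t"
proof -
  obtain p q d where pqd: "recursive 2 p" "recursive 2 q" "recursive 2 d"
    and approx: "\<And>a s. \<bar>(real (p [e a, s]) - real (q [e a, s])) / real (Suc (d [e a, s])) - r a\<bar> \<le> 1 / 2 ^ s"
    using assms(1) unfolding computable_reals_def by blast
  define P where "P = (\<lambda>c t. 2 ^ t * (p [c, t] - q [c, t]) div Suc (d [c, t]))"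
  have rec2: "computable 2 (\<lambda>xs. h [xs ! 0, xs ! 1])" if "recursive 2 h" for h
  proof (rule computable_cong)
    show "computable 2 h" using that unfolding computable_def by blast
    show "h xs = h [xs ! 0, xs ! 1]" if "length xs = 2" for xs
      using that by (cases xs; cases "tl xs") auto
  qed
  have "computable 2 (\<lambda>xs. P (xs ! 0) (xs ! 1))"
    unfolding P_def
    by (intro computable_div computable_mult computable_pow2 computable_diff computable_Suc rec2 pqd computable_nth) auto
  moreover have "\<bar>real (P (e a) t) / 2 ^ t - r a\<bar> \<le> 2 / 2 ^ t" for a t
  proof -
    define D where "D = real (Suc (d [e a, t]))"
    define x where "x = real (p [e a, t] - q [e a, t]) / D"
    have D: "D > 0" by (simp add: D_def)
    have x: "\<bar>x - r a\<bar> \<le> 1 / 2 ^ t"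
      \<comment> \<open>If the numerator is truncated, then \<open>r a\<close> lies between the truncated value \<open>0\<close> and the
        error bound.\<close>
    proof (cases "q [e a, t] \<le> p [e a, t]")
      case True
      thus ?thesis using approx[of a t] by (simp add: x_def D_def of_nat_diff)
    next
      case False
      hence "(real (p [e a, t]) - real (q [e a, t])) / D \<le> 0"
        using D by (simp add: divide_nonpos_pos)
      moreover have "x = 0" using False by (simp add: x_def)
      ultimately show ?thesis using approx[of a t] assms(2)[of a] unfolding D_def by linarith
    qed
    have "real (P (e a) t) = of_int \<lfloor>2 ^ t * x\<rfloor>"
      unfolding P_def x_def D_def
      using floor_divide_of_nat_eq[of "2 ^ t * (p [e a, t] - q [e a, t])" "Suc (d [e a, t])", where 'a = real]
      by simp
    hence "\<bar>real (P (e a) t) - 2 ^ t * x\<bar> \<le> 1"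
      by linarith
    hence "\<bar>real (P (e a) t) / 2 ^ t - x\<bar> \<le> 1 / 2 ^ t"
      by (simp add: abs_le_iff field_simps)
    thus ?thesis using x by (simp add: abs_le_iff)
  qed
  ultimately show thesis using that by blast
qed

text \<open>The measure of \<open>U i\<close> is computed up to \<open>2\<^sup>-\<^sup>s\<close> from the strings of length
  \<open>N = a (i + s + 1)\<close>. Whatever \<open>U i\<close> contains beyond the cylinders of strings shorter than \<open>N\<close> lies
  in \<open>U (i + s + 1)\<close>, hence has measure at most \<open>2\<^sup>-\<^sup>s\<^sup>-\<^sup>1\<close>. The remaining part is the disjoint union
  of the cylinders of those strings of length \<open>N\<close> that have a suitable prefix, and is therefore a
  finite sum. It has at most \<open>2\<^sup>N\<close> terms, so computing each of them up to \<open>2\<^sup>-\<^sup>N\<^sup>-\<^sup>s\<^sup>-\<^sup>1\<close>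
  uses up the other half of the permitted error.\<close>

lemma computable_open_measure:
  assumes \<mu>: "prob_space \<mu>" "sets \<mu> = sets cantor" "computable_measure \<mu>"
    and Q: "decidable 1 (\<lambda>xs. Q (xs ! 0))"
    and U: "U = (\<lambda>i. \<Union>\<sigma>\<in>{\<sigma>. Q (val \<sigma>) \<and> a * i \<le> length \<sigma>}. cyl \<sigma>)"
    and small: "\<And>i. measure \<mu> (U i) \<le> 1 / 2 ^ i"
  shows "computable_reals (\<lambda>i. i) (\<lambda>i. measure \<mu> (U i))"
proof -
  interpret prob_space \<mu> by fact
  have QI: "decidable k (\<lambda>xs. Q (f xs))" if "computable k f" for k f
    using computable_comp1[OF Q[unfolded decidable_def] that] unfolding decidable_def .
  obtain P where P: "computable 2 (\<lambda>xs. P (xs ! 0) (xs ! 1))"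
    "\<And>\<sigma> t. \<bar>real (P (code \<sigma>) t) / 2 ^ t - measure \<mu> (cyl \<sigma>)\<bar> \<le> 2 / 2 ^ t"
    using computable_reals_dyadic[OF \<mu>(3)[unfolded computable_measure_def]] by (auto simp: measure_nonneg)
  \<comment> \<open>The string with number \<open>u\<close> has a prefix that contributes its cylinder to \<open>U i\<close>.\<close>
  define H where "H = (\<lambda>u i. \<exists>j<u. Q (u div 2 ^ j) \<and> 2 ^ (a * i) \<le> u div 2 ^ j)"
  define N where "N = (\<lambda>i s. a * (i + s + 1))"
  \<comment> \<open>The approximation, as the numerator of a fraction with denominator \<open>2\<^sup>N\<^sup>+\<^sup>s\<^sup>+\<^sup>2\<close>.\<close>
  define V where "V = (\<lambda>i s. \<Sum>v<2 ^ N i s. of_bool (H (2 ^ N i s + v) i) * P (2 ^ N i s + v - 1) (N i s + s + 2))"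
  have H: "decidable 2 (\<lambda>xs. H (xs ! 0) (xs ! 1))"
    unfolding H_def
    by (intro decidable_bex decidable_and decidable_le QI computable_div computable_mult computable_pow2 computable_const computable_nth
        computable_hd computable_tl) auto
  have N: "computable k (\<lambda>xs. N (f xs) (g xs))" if "computable k f" "computable k g" for k f g
    unfolding N_def by (intro computable_mult computable_add computable_const that)
  have V: "computable 2 (\<lambda>xs. V (xs ! 0) (xs ! 1))"
    unfolding V_def
    by (intro computable_sum computable_mult computable_comp2[OF H[unfolded decidable_def]]
        computable_comp2[OF P(1)] N computable_add computable_diff computable_pow2 computable_const
        computable_nth computable_hd computable_tl) auto
  have D: "computable 2 (\<lambda>xs. 2 ^ (N (xs ! 0) (xs ! 1) + (xs ! 1) + 2) - 1)"
    by (intro computable_diff computable_pow2 computable_add N computable_const computable_nth) auto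
  have approx: "\<bar>real (V i s) / 2 ^ (N i s + s + 2) - measure \<mu> (U i)\<bar> \<le> 1 / 2 ^ s" for i s
  proof -
    define M where "M = N i s"
    define t where "t = M + s + 2"
    define S where "S = {\<sigma>. length \<sigma> = M \<and> H (val \<sigma>) i}"
    have S: "finite S" "card S \<le> 2 ^ M"
    proof -
      show "finite S" using finite_strings[of M] by (simp add: S_def)
      have "card S \<le> card {\<sigma> :: bool list. length \<sigma> = M}"
        by (rule card_mono) (auto simp: S_def finite_strings)
      thus "card S \<le> 2 ^ M" using card_lists_length_eq[of "UNIV :: bool set" M] by simp
    qed
    have sub: "(\<Union>\<sigma>\<in>S. cyl \<sigma>) \<subseteq> U i"
    proof
      fix X assume "X \<in> (\<Union>\<sigma>\<in>S. cyl \<sigma>)"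
      then obtain \<sigma> j where \<sigma>: "X \<in> cyl \<sigma>" "Q (val \<sigma> div 2 ^ j)" "2 ^ (a * i) \<le> val \<sigma> div 2 ^ j"
        by (auto simp: S_def H_def)
      have "j \<le> length \<sigma>"
      proof (rule ccontr)
        assume "\<not> j \<le> length \<sigma>"
        hence "(2 :: nat) ^ (length \<sigma> + 1) \<le> 2 ^ j" by (intro power_increasing) auto
        hence "val \<sigma> < 2 ^ j" using val_bounds(2)[of \<sigma>] by linarith
        thus False using \<sigma>(3) by simp
      qed
      hence "val \<sigma> div 2 ^ j = val (take (length \<sigma> - j) \<sigma>)" by (rule val_take)
      hence "take (length \<sigma> - j) \<sigma> \<in> {\<sigma>. Q (val \<sigma>) \<and> a * i \<le> length \<sigma>}"
        using \<sigma>(2,3) le_val_iff[of "a * i" "take (length \<sigma> - j) \<sigma>"] by simp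
      moreover have "X \<in> cyl (take (length \<sigma> - j) \<sigma>)"
        using \<sigma>(1) by (simp add: mem_cyl)
      ultimately show "X \<in> U i" unfolding U by blast
    qed
    have sup: "U i \<subseteq> (\<Union>\<sigma>\<in>S. cyl \<sigma>) \<union> U (i + s + 1)"
    proof
      fix X assume "X \<in> U i"
      then obtain \<tau> where \<tau>: "X \<in> cyl \<tau>" "Q (val \<tau>)" "a * i \<le> length \<tau>"
        unfolding U by blast
      show "X \<in> (\<Union>\<sigma>\<in>S. cyl \<sigma>) \<union> U (i + s + 1)"
      proof (cases "M \<le> length \<tau>")
        case True
        thus ?thesis using \<tau> unfolding U M_def N_def by blast
      next
        case False
        define j where "j = M - length \<tau>"
        have "val (init X M) div 2 ^ j = val \<tau>"
          using val_take[of j "init X M"] False \<tau>(1) by (simp add: j_def cyl_def min_def)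
        moreover have "j < val (init X M)"
          using val_bounds(1)[of "init X M"] less_exp[of M] unfolding j_def length_init by linarith
        moreover have "2 ^ (a * i) \<le> val \<tau>" using \<tau>(3) by (simp add: le_val_iff)
        ultimately have "init X M \<in> S"
          using \<tau>(2) unfolding S_def H_def by auto
        moreover have "X \<in> cyl (init X M)" by (simp add: cyl_def)
        ultimately show ?thesis by blast
      qed
    qed
    have meas: "measure \<mu> (\<Union>\<sigma>\<in>S. cyl \<sigma>) = (\<Sum>\<sigma>\<in>S. measure \<mu> (cyl \<sigma>))"
      by (rule measure_Union_cyl[OF \<mu>(1,2), of _ M]) (auto simp: S_def)
    have ev: "U i \<in> events" "(\<Union>\<sigma>\<in>S. cyl \<sigma>) \<in> events" for i
      unfolding U using Union_cyl_sets \<mu>(2) by auto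
    have lo: "measure \<mu> (\<Union>\<sigma>\<in>S. cyl \<sigma>) \<le> measure \<mu> (U i)"
      by (intro finite_measure_mono sub ev)
    have "measure \<mu> (U i) \<le> measure \<mu> ((\<Union>\<sigma>\<in>S. cyl \<sigma>) \<union> U (i + s + 1))"
      by (intro finite_measure_mono sup sets.Un ev)
    also have "\<dots> \<le> measure \<mu> (\<Union>\<sigma>\<in>S. cyl \<sigma>) + measure \<mu> (U (i + s + 1))"
      by (intro measure_Un_le ev)
    also have "\<dots> \<le> measure \<mu> (\<Union>\<sigma>\<in>S. cyl \<sigma>) + 1 / 2 ^ (s + 1)"
    proof -
      have "1 / 2 ^ (i + s + 1) \<le> (1 / 2 ^ (s + 1) :: real)"
        by (intro divide_left_mono power_increasing) auto
      thus ?thesis using small[of "i + s + 1"] by linarith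
    qed
    finally have hi: "measure \<mu> (U i) \<le> measure \<mu> (\<Union>\<sigma>\<in>S. cyl \<sigma>) + 1 / 2 ^ (s + 1)" .
    have "V i s = (\<Sum>\<sigma> | length \<sigma> = M. of_bool (H (val \<sigma>) i) * P (code \<sigma>) t)"
      unfolding V_def code_eq_val M_def t_def
      by (rule sum_strings_val[where f = "\<lambda>u. of_bool (H u i) * P (u - 1) (N i s + s + 2)", symmetric])
    also have "\<dots> = (\<Sum>\<sigma>\<in>S. P (code \<sigma>) t)"
      by (rule sum.mono_neutral_cong_right) (auto simp: S_def finite_strings)
    finally have "real (V i s) / 2 ^ t - measure \<mu> (\<Union>\<sigma>\<in>S. cyl \<sigma>) =
        (\<Sum>\<sigma>\<in>S. real (P (code \<sigma>) t) / 2 ^ t - measure \<mu> (cyl \<sigma>))"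
      by (simp add: meas sum_subtractf sum_divide_distrib)
    also have "\<bar>\<dots>\<bar> \<le> (\<Sum>\<sigma>\<in>S. 2 / 2 ^ t)"
      by (rule order.trans[OF sum_abs]) (intro sum_mono P(2))
    also have "\<dots> \<le> 2 ^ M * (2 / 2 ^ t)"
      using S(2) by (simp add: divide_right_mono)
    also have "\<dots> = 1 / 2 ^ (s + 1)"
      by (simp add: t_def power_add)
    finally have "\<bar>real (V i s) / 2 ^ t - measure \<mu> (\<Union>\<sigma>\<in>S. cyl \<sigma>)\<bar> \<le> 1 / 2 ^ (s + 1)" .
    moreover have "1 / 2 ^ (s + 1) + 1 / 2 ^ (s + 1) = (1 / 2 ^ s :: real)" by simp
    ultimately show ?thesis using lo hi unfolding t_def M_def by linarith
  qed
  obtain v d where "recursive 2 v" "recursive 2 d"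
    and vd: "\<And>xs. length xs = 2 \<Longrightarrow> v xs = V (xs ! 0) (xs ! 1)"
      "\<And>xs. length xs = 2 \<Longrightarrow> d xs = 2 ^ (N (xs ! 0) (xs ! 1) + (xs ! 1) + 2) - 1"
    using V D unfolding computable_def by blast
  moreover have "real (Suc (2 ^ m - 1)) = 2 ^ m" for m
    by simp
  ultimately show ?thesis
    unfolding computable_reals_def using approx
    by (intro exI[of _ v] exI[of _ "\<lambda>_. 0"] exI[of _ d]) (simp add: recursive.zero vd del: power_Suc of_nat_Suc)
qed

text \<open>If a decidable property holds for some long prefix only with small probability, and the
  probability shrinks at a known rate with the length, then it eventually fails along each
  Schnorr random sequence: the sets of sequences with a late prefix of this kind form a Schnorr test.
  The property is given on the numbers \<open>val \<sigma>\<close>, on which the decision procedure operates.\<close>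

lemma schnorr_borel_cantelli:
  assumes \<mu>: "prob_space \<mu>" "sets \<mu> = sets cantor" "computable_measure \<mu>"
    and Q: "decidable 1 (\<lambda>xs. Q (xs ! 0))"
    and small: "\<And>i. measure \<mu> (\<Union>\<sigma>\<in>{\<sigma>. Q (val \<sigma>) \<and> a * i \<le> length \<sigma>}. cyl \<sigma>) \<le> 1 / 2 ^ i"
    and X: "schnorr_random \<mu> X"
  shows "eventually (\<lambda>m. \<not> Q (val (init X m))) sequentially"
proof -
  define U where "U = (\<lambda>i. \<Union>\<sigma>\<in>{\<sigma>. Q (val \<sigma>) \<and> a * i \<le> length \<sigma>}. cyl \<sigma>)"
  have QI: "decidable k (\<lambda>xs. Q (f xs))" if "computable k f" for k f
    using computable_comp1[OF Q[unfolded decidable_def] that] unfolding decidable_def .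
  define W where "W = {xs :: nat list. Q (xs ! 1 + 1) \<and> 2 ^ (a * xs ! 0) \<le> xs ! 1 + 1}"
  have "decidable 2 (\<lambda>xs. xs \<in> W)"
    unfolding W_def mem_Collect_eq
    by (intro decidable_and decidable_le QI computable_pow2 computable_mult computable_add
        computable_nth computable_const) auto
  hence "ce 2 W" by (rule ce_decidable)
  moreover have "U i = \<Union> {cyl \<sigma> | \<sigma>. [i, code \<sigma>] \<in> W}" for i
    by (auto simp: U_def W_def val_def[symmetric] le_val_iff simp del: One_nat_def)
  ultimately have "uniformly_effectively_open U"
    unfolding uniformly_effectively_open_def by blast
  hence "schnorr_test \<mu> U"
    using computable_open_measure[OF \<mu> Q U_def] small unfolding schnorr_test_def U_def by blast
  then obtain i where i: "X \<notin> U i"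
    using X unfolding schnorr_random_def by blast
  have "\<not> Q (val (init X m))" if "a * i \<le> m" for m
  proof
    assume "Q (val (init X m))"
    hence "init X m \<in> {\<sigma>. Q (val \<sigma>) \<and> a * i \<le> length \<sigma>}" using that by simp
    moreover have "X \<in> cyl (init X m)" by (simp add: cyl_def)
    ultimately show False using i unfolding U_def by blast
  qed
  thus ?thesis unfolding eventually_sequentially by blast
qed

section \<open>Blocks of a sequence\<close>

definition blk :: "nat \<Rightarrow> (nat \<Rightarrow> bool) \<Rightarrow> nat \<Rightarrow> bool list" where
  "blk n X j = map X [n * j..<n * j + n]"

definition blk_sum :: "nat \<Rightarrow> (bool list \<Rightarrow> nat) \<Rightarrow> (nat \<Rightarrow> bool) \<Rightarrow> nat \<Rightarrow> nat" where
  "blk_sum n g X k = (\<Sum>j<k. g (blk n X j))"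

lemma length_blk [simp]: "length (blk n X j) = n"
  by (simp add: blk_def)

lemma blk_join_blocks: "length (B j) = n \<Longrightarrow> blk n (join_blocks n B) j = B j"
  by (rule nth_equalityI) (auto simp: blk_def join_blocks_def)

lemma init_add_blk: "init X (n * k) @ blk n X k = init X (n * Suc k)"
  using upt_add_eq_append[of 0 "n * k" n] by (simp add: init_def blk_def add.commute)

lemma concat_blk: "concat (map (blk n X) [0..<k]) = init X (n * k)"
proof (induction k)
  case (Suc k)
  thus ?case using init_add_blk[of X n k] by simp
qed (simp add: init_def)

text \<open>The blocks of a string of length \<open>n k\<close> are the base-\<open>2\<^sup>n\<close> digits of its number, the last
  block being the least significant digit. Adding \<open>2\<^sup>n\<close> to a digit supplies the leading one in the
  number of the block.\<close>

lemma blk_digit: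
  assumes "j < k"
  shows "val (init X (n * k)) div 2 ^ (n * j) mod 2 ^ n + 2 ^ n = val (blk n X (k - Suc j))"
proof -
  define i where "i = k - Suc j"
  have "k = Suc i + j" using assms by (simp add: i_def)
  hence "n * k = n * Suc i + n * j" by (simp add: algebra_simps)
  hence "val (init X (n * k)) div 2 ^ (n * j) = val (init X (n * Suc i))"
    using val_take[of "n * j" "init X (n * k)"] by simp
  also have "\<dots> = val (init X (n * i)) * 2 ^ n + (val (blk n X i) - 2 ^ n)"
    unfolding init_add_blk[symmetric] val_append by simp
  also have "\<dots> mod 2 ^ n = val (blk n X i) - 2 ^ n"
    unfolding mod_mult_self3 using val_bounds[of "blk n X i"] by (intro mod_less) simp
  finally show ?thesis
    using val_bounds(1)[of "blk n X i"] by (simp add: i_def)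
qed

text \<open>For the string of number \<open>u\<close>, whose length must be a multiple \<open>n k\<close> of \<open>n\<close>, the average of \<open>g\<close>
  over its \<open>k\<close> blocks exceeds the rational \<open>c / b\<close>. The condition is put in terms of the digits of \<open>u\<close>
  to make it visibly decidable; the sum runs through the blocks backwards.\<close>

definition deviates :: "nat \<Rightarrow> (bool list \<Rightarrow> nat) \<Rightarrow> nat \<Rightarrow> nat \<Rightarrow> nat \<Rightarrow> bool" where
  "deviates n g b c u \<longleftrightarrow> (\<exists>k<u. u div 2 ^ (n * k) = 1 \<and>
     c * k < b * (\<Sum>j<k. g (inv val (u div 2 ^ (n * j) mod 2 ^ n + 2 ^ n))))"

lemma decidable_deviates: "decidable 1 (\<lambda>xs. deviates n g b c (xs ! 0))"
  unfolding deviates_def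
  by (intro decidable_bex decidable_and decidable_eq decidable_less
      computable_finite_table[where G = "\<lambda>v. g (inv val (v + 2 ^ n))" and M = "2 ^ n"]
      computable_sum computable_mod computable_div computable_mult computable_pow2
      computable_const computable_nth computable_hd computable_tl) auto

lemma deviates_init:
  assumes "1 \<le> n"
  shows "deviates n g b c (val (init X m)) \<longleftrightarrow> (\<exists>k. m = n * k \<and> c * k < b * blk_sum n g X k)"
proof -
  have sum: "(\<Sum>j<k. g (inv val (val (init X (n * k)) div 2 ^ (n * j) mod 2 ^ n + 2 ^ n)))
      = blk_sum n g X k" for k
  proof -
    have "(\<Sum>j<k. g (inv val (val (init X (n * k)) div 2 ^ (n * j) mod 2 ^ n + 2 ^ n)))
      = (\<Sum>j<k. g (blk n X (k - Suc j)))"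
      by (rule sum.cong) (auto simp: blk_digit inv_f_f[OF inj_val])
    thus ?thesis
      using sum.nat_diff_reindex[of "\<lambda>j. g (blk n X j)" k] by (simp add: blk_sum_def)
  qed
  \<comment> \<open>A quotient of one means that only the leading one is left after dropping \<open>l\<close> bits.\<close>
  have len: "val (init X m) div 2 ^ l = 1 \<longleftrightarrow> m = l" for l
  proof (cases "l \<le> m")
    case True
    have "val (init X m) div 2 ^ l = 1 \<longleftrightarrow> val (init X (m - l)) = val []"
      using True val_take[of l "init X m"] by simp
    also have "\<dots> \<longleftrightarrow> m - l = 0"
      unfolding inj_eq[OF inj_val] by (metis length_0_conv length_init)
    finally show ?thesis using True by auto
  next
    case False
    thus ?thesis using le_val_iff[of l "init X m"] by (simp add: div_less)
  qed
  have "deviates n g b c (val (init X m)) \<longleftrightarrow>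
      (\<exists>k<val (init X m). m = n * k \<and> c * k < b * blk_sum n g X k)"
    unfolding deviates_def len by (simp only: sum cong: conj_cong)
  moreover have "k < val (init X (n * k))" for k
  proof -
    have "k \<le> n * k" using assms by simp
    also have "\<dots> < 2 ^ (n * k)" by (rule less_exp)
    also have "\<dots> \<le> val (init X (n * k))" using val_bounds(1)[of "init X (n * k)"] by simp
    finally show ?thesis .
  qed
  ultimately show ?thesis by blast
qed

text \<open>Strings form a countable set, so measurability reduces to that of the cylinders.\<close>

lemma measurable_init [measurable]: "(\<lambda>X. init X m) \<in> measurable cantor (count_space UNIV)"
proof (subst measurable_count_space_eq2_countable, safe)
  fix \<sigma> :: "bool list"
  have "(\<lambda>X. init X m) -` {\<sigma>} \<inter> space cantor = (if length \<sigma> = m then cyl \<sigma> else {})"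
    by (auto simp: cyl_def)
  thus "(\<lambda>X. init X m) -` {\<sigma>} \<inter> space cantor \<in> sets cantor" by simp
qed auto

lemma measurable_blk [measurable]: "(\<lambda>X. blk n X j) \<in> measurable cantor (count_space UNIV)"
proof -
  have "blk n X j = drop (n * j) (init X (n * j + n))" for X
    by (simp add: blk_def init_def drop_map)
  thus ?thesis using measurable_compose[OF measurable_init, of "drop (n * j)" "count_space UNIV"] by simp
qed


section \<open>The law of large numbers for block sums\<close>

lemma borel_measurable_blk:
  "(\<lambda>X. f (blk n X j)) \<in> borel_measurable cantor" for f :: "bool list \<Rightarrow> real"
  by (rule measurable_compose[OF measurable_blk]) simp

text \<open>An \<open>n\<close>-step Bernoulli measure together with a distribution \<open>P\<close> of its blocks. Probabilistic
  arguments take place on the product space \<open>\<Omega>\<close>, whose coordinates are the blocks, and are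
  transferred to \<open>\<mu>\<close> along \<open>join_blocks\<close>.\<close>

locale bernoulli_blocks = P: prob_space P for P :: "bool list measure" +
  fixes n :: nat and \<mu> :: "(nat \<Rightarrow> bool) measure"
  assumes n: "1 \<le> n"
    and sets_P: "sets P = Pow {\<sigma>. length \<sigma> = n}"
    and \<mu>_eq: "\<mu> = distr (Pi\<^sub>M UNIV (\<lambda>_ :: nat. P)) cantor (join_blocks n)"
begin

abbreviation \<Omega> :: "(nat \<Rightarrow> bool list) measure" where
  "\<Omega> \<equiv> Pi\<^sub>M UNIV (\<lambda>_ :: nat. P)"

lemma space_P: "space P = {\<sigma>. length \<sigma> = n}"
  using sets_eq_imp_space_eq[of P "count_space {\<sigma>. length \<sigma> = n}"] sets_P by simp

lemma measurable_P: "f \<in> measurable P (count_space UNIV)"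
  using sets_P space_P by (auto simp: measurable_def)

lemma borel_P [measurable]: "f \<in> borel_measurable P" for f :: "bool list \<Rightarrow> real"
  using measurable_compose[OF measurable_P[of "\<lambda>x. x"], of f borel] by simp

lemma prob_space_\<Omega>: "prob_space \<Omega>"
  by (intro prob_space_PiM P.prob_space_axioms)

lemma measurable_join [measurable]: "join_blocks n \<in> measurable \<Omega> cantor"
  by (rule measurable_join_blocks[OF sets_P])

lemma sets_\<mu> [measurable_cong]: "sets \<mu> = sets cantor"
  by (simp add: \<mu>_eq)

lemma prob_space_\<mu>: "prob_space \<mu>"
  unfolding \<mu>_eq by (rule prob_space.prob_space_distr[OF prob_space_\<Omega>]) simp

lemma blk_sum_join: "B \<in> space \<Omega> \<Longrightarrow> blk n (join_blocks n B) j = B j"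
  by (rule blk_join_blocks) (auto simp: space_PiM space_P)

lemma bounded_g: "\<exists>M>0. \<forall>\<sigma>\<in>space P. g \<sigma> \<le> M" for g :: "bool list \<Rightarrow> nat"
proof -
  have "g \<sigma> \<le> Suc (Max (g ` {\<sigma>. length \<sigma> = n}))" if "length \<sigma> = n" for \<sigma>
    using that finite_strings[of n] by (intro le_SucI Max_ge) auto
  thus ?thesis by (auto simp: space_P intro!: exI[of _ "Suc (Max (g ` {\<sigma>. length \<sigma> = n}))"])
qed

lemma integrable_g [simp]: "integrable P (\<lambda>\<sigma>. real (g \<sigma>))"
proof -
  obtain M where "\<forall>\<sigma>\<in>space P. g \<sigma> \<le> M" using bounded_g[of g] by auto
  thus ?thesis by (intro P.integrable_const_bound[of _ "real M"]) auto
qed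

lemma distr_component: "distr \<Omega> P (\<lambda>B. B j) = P"
  by (rule distr_PiM_component) (auto intro: P.prob_space_axioms)

lemma expectation_component: "(\<integral>B. real (g (B j)) \<partial>\<Omega>) = (\<integral>\<sigma>. real (g \<sigma>) \<partial>P)"
proof -
  have "(\<integral>\<sigma>. real (g \<sigma>) \<partial>distr \<Omega> P (\<lambda>B. B j)) = (\<integral>B. real (g (B j)) \<partial>\<Omega>)"
    by (rule integral_distr) auto
  thus ?thesis by (simp add: distr_component)
qed

lemma indep_components: "prob_space.indep_vars \<Omega> (\<lambda>_. P) (\<lambda>j B. B j) UNIV"
proof (subst prob_space.indep_vars_iff_distr_eq_PiM')
  have "distr \<Omega> \<Omega> (\<lambda>B. \<lambda>i\<in>UNIV. B i) = \<Omega>"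
    by (simp add: restrict_def distr_id)
  thus "distr \<Omega> (Pi\<^sub>M UNIV (\<lambda>_. P)) (\<lambda>B. \<lambda>i\<in>UNIV. B i) = Pi\<^sub>M UNIV (\<lambda>i. distr \<Omega> P (\<lambda>B. B i))"
    by (simp add: distr_component)
qed (auto simp: prob_space_\<Omega>)

text \<open>Hoeffding's inequality for the first \<open>k\<close> blocks. With values in \<open>[0, M]\<close> and an excess of
  \<open>k e\<close> over the mean, its bound is the \<open>k\<close>-th power of \<open>exp (- 2 e\<^sup>2 / M\<^sup>2)\<close>.\<close>

lemma exponential_decay:
  assumes "(\<integral>\<sigma>. real (g \<sigma>) \<partial>P) < x"
  obtains r where "0 < r" "r < 1" "\<And>k. measure \<mu> {X. x * real k \<le> real (blk_sum n g X k)} \<le> r ^ k"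
proof -
  define E where "E = (\<integral>\<sigma>. real (g \<sigma>) \<partial>P)"
  define e where "e = x - E"
  have e: "0 < e" using assms by (simp add: e_def E_def)
  obtain M where M: "M > 0" "\<And>\<sigma>. \<sigma> \<in> space P \<Longrightarrow> g \<sigma> \<le> M" using bounded_g[of g] by blast
  define r where "r = exp (- 2 * e\<^sup>2 / (real M)\<^sup>2)"
  have "measure \<mu> {X. x * real k \<le> real (blk_sum n g X k)} \<le> r ^ k" for k
  proof (cases "k = 0")
    case True
    thus ?thesis using prob_space.prob_le_1[OF prob_space_\<mu>] by simp
  next
    case False
    interpret \<Omega>: prob_space \<Omega> by (rule prob_space_\<Omega>)
    interpret Hoeffding_ineq \<Omega> "{..<k}" "\<lambda>j B. real (g (B j))" "\<lambda>_. 0" "\<lambda>_. real M" "real k * E"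
    proof unfold_locales
      have "\<Omega>.indep_vars (\<lambda>_. borel) (\<lambda>j B. real (g (B j))) UNIV"
        by (rule \<Omega>.indep_vars_compose2[OF indep_components]) simp
      thus "\<Omega>.indep_vars (\<lambda>_. borel) (\<lambda>j B. real (g (B j))) {..<k}"
        by (rule \<Omega>.indep_vars_subset) simp
      show "AE B in \<Omega>. real (g (B i)) \<in> {0..real M}" for i
        using M(2) by (intro AE_I2) (auto simp: space_PiM PiE_iff)
      show "real k * E \<equiv> \<Sum>i<k. \<integral>B. real (g (B i)) \<partial>\<Omega>"
        by (simp add: expectation_component E_def)
    qed simp
    have "measure \<mu> {X. x * real k \<le> real (blk_sum n g X k)} =
        measure \<Omega> (join_blocks n -` {X. x * real k \<le> real (blk_sum n g X k)} \<inter> space \<Omega>)"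
    proof -
      have "{X \<in> space cantor. x * real k \<le> real (blk_sum n g X k)} \<in> sets cantor"
        unfolding blk_sum_def by measurable
      thus ?thesis unfolding \<mu>_eq by (intro measure_distr) auto
    qed
    also have "join_blocks n -` {X. x * real k \<le> real (blk_sum n g X k)} \<inter> space \<Omega> =
        {B \<in> space \<Omega>. real k * E + real k * e \<le> (\<Sum>j<k. real (g (B j)))}"
      by (auto simp: blk_sum_def blk_sum_join e_def algebra_simps)
    also have "measure \<Omega> \<dots> \<le> exp (- 2 * (real k * e)\<^sup>2 / (\<Sum>j<k. (real M - 0)\<^sup>2))"
      by (rule Hoeffding_ineq_ge) (use e False M(1) in auto)
    also have "\<dots> = exp (real k * (- 2 * e\<^sup>2 / (real M)\<^sup>2))"
      using False by (simp add: power2_eq_square field_simps)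
    also have "\<dots> = r ^ k"
      unfolding r_def by (rule exp_of_nat_mult)
    finally show ?thesis .
  qed
  moreover have "0 < r" "r < 1" using e M(1) by (auto simp: r_def)
  ultimately show thesis using that by blast
qed

text \<open>By \<open>exponential_decay\<close> the probability of a deviation at some time \<open>k \<ge> a i\<close> is at most the
  geometric tail \<open>r\<^sup>a\<^sup>i / (1 - r)\<close>. Choosing \<open>a\<close> such that \<open>r\<^sup>a < (1 - r) / 2\<close> absorbs the factor
  \<open>1 / (1 - r)\<close> for \<open>i \<ge> 1\<close> and leaves \<open>2\<^sup>-\<^sup>i\<close>; for \<open>i = 0\<close> the bound is trivial.\<close>

lemma tail_bound:
  assumes "(\<integral>\<sigma>. real (g \<sigma>) \<partial>P) < x"
  obtains a where "\<And>i. measure \<mu> {X. \<exists>k\<ge>a * i. x * real k \<le> real (blk_sum n g X k)} \<le> 1 / 2 ^ i"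
proof -
  interpret \<mu>: prob_space \<mu> by (rule prob_space_\<mu>)
  obtain r where r: "0 < r" "r < 1"
    "\<And>k. measure \<mu> {X. x * real k \<le> real (blk_sum n g X k)} \<le> r ^ k"
    using exponential_decay[OF assms] by blast
  obtain a where a: "r ^ a < (1 - r) / 2"
    using real_arch_pow_inv[of "(1 - r) / 2" r] r by auto
  define A where "A = (\<lambda>k. {X. x * real k \<le> real (blk_sum n g X k)})"
  have A: "A k \<in> \<mu>.events" for k
  proof -
    have "{X \<in> space cantor. x * real k \<le> real (blk_sum n g X k)} \<in> sets cantor"
      unfolding blk_sum_def by measurable
    thus ?thesis by (simp add: A_def sets_\<mu>)
  qed
  have "measure \<mu> {X. \<exists>k\<ge>a * i. x * real k \<le> real (blk_sum n g X k)} \<le> 1 / 2 ^ i" for i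
  proof (cases "i = 0")
    case False
    have geo: "(\<lambda>k. r ^ (k + a * i)) sums (r ^ (a * i) / (1 - r))"
      using sums_mult[OF geometric_sums[of r], of "r ^ (a * i)"] r by (simp add: power_add mult.commute)
    have le: "measure \<mu> (A (k + a * i)) \<le> r ^ (k + a * i)" for k
      unfolding A_def by (rule r(3))
    have summ: "summable (\<lambda>k. measure \<mu> (A (k + a * i)))"
      by (rule summable_comparison_test'[OF sums_summable[OF geo]]) (simp add: le)
    have "{X. \<exists>k\<ge>a * i. x * real k \<le> real (blk_sum n g X k)} = (\<Union>k. A (k + a * i))"
    proof -
      have "(\<exists>k\<ge>K. R k) \<longleftrightarrow> (\<exists>k. R (k + K))" for K :: nat and R
        by (metis le_add2 le_add_diff_inverse2)
      thus ?thesis by (simp only: A_def UNION_eq mem_Collect_eq UNIV_I bex_UNIV simp_thms)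
    qed
    also have "measure \<mu> \<dots> \<le> (\<Sum>k. measure \<mu> (A (k + a * i)))"
      using A summ by (intro \<mu>.finite_measure_subadditive_countably) auto
    also have "\<dots> \<le> (\<Sum>k. r ^ (k + a * i))"
      by (intro suminf_le le summ sums_summable[OF geo])
    also have "\<dots> = (r ^ a) ^ i / (1 - r)"
      using sums_unique[OF geo] by (simp add: power_mult)
    also have "\<dots> \<le> ((1 - r) / 2) ^ i / (1 - r)"
      using a r by (intro divide_right_mono power_mono) auto
    also have "\<dots> = (1 - r) ^ (i - 1) / 2 ^ i"
      using False r by (cases i) (simp_all add: power_divide)
    also have "\<dots> \<le> 1 / 2 ^ i"
      using r by (intro divide_right_mono power_le_one) auto
    finally show ?thesis .
  qed simp
  thus thesis using that by blast
qed

text \<open>The upper half of the law of large numbers. The threshold \<open>x\<close> is first lowered to a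
  rational \<open>c / b\<close> that still exceeds the mean, since comparison with a rational is decidable.\<close>

lemma eventually_blk_sum_le:
  assumes "computable_measure \<mu>" "schnorr_random \<mu> X" "(\<integral>\<sigma>. real (g \<sigma>) \<partial>P) < x"
  shows "eventually (\<lambda>k. real (blk_sum n g X k) \<le> x * real k) sequentially"
proof -
  interpret \<mu>: prob_space \<mu> by (rule prob_space_\<mu>)
  have "0 \<le> (\<integral>\<sigma>. real (g \<sigma>) \<partial>P)" by simp
  moreover obtain q where q: "q \<in> \<rat>" "(\<integral>\<sigma>. real (g \<sigma>) \<partial>P) < q" "q < x"
    using Rats_dense_in_real[OF assms(3)] by blast
  ultimately obtain c b :: nat where b: "b \<noteq> 0" "q = real c / real b"
    using Rats_abs_nat_div_natE[OF q(1)] by (metis abs_of_pos order.strict_trans1)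
  have dev: "c * k < b * s \<longleftrightarrow> q * real k < real s" for k s
  proof -
    have "q * real k < real s \<longleftrightarrow> real c * real k < real b * real s"
      using b by (simp add: pos_divide_less_eq mult.commute)
    also have "\<dots> \<longleftrightarrow> c * k < b * s"
      by (simp only: of_nat_mult[symmetric] of_nat_less_iff)
    finally show ?thesis by simp
  qed
  obtain a where a: "\<And>i. measure \<mu> {X. \<exists>k\<ge>a * i. q * real k \<le> real (blk_sum n g X k)} \<le> 1 / 2 ^ i"
    using tail_bound[OF q(2)] by blast
  have "eventually (\<lambda>m. \<not> deviates n g b c (val (init X m))) sequentially"
  proof (rule schnorr_borel_cantelli[OF prob_space_\<mu> sets_\<mu> assms(1) decidable_deviates _ assms(2)])
    fix i
    have "(\<Union>\<sigma>\<in>{\<sigma>. deviates n g b c (val \<sigma>) \<and> n * a * i \<le> length \<sigma>}. cyl \<sigma>)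
        \<subseteq> {X. \<exists>k\<ge>a * i. q * real k \<le> real (blk_sum n g X k)}"
    proof clarify
      fix Y \<sigma> assume *: "deviates n g b c (val \<sigma>)" "n * a * i \<le> length \<sigma>" "Y \<in> cyl \<sigma>"
      from * have "deviates n g b c (val (init Y (length \<sigma>)))" by (simp add: cyl_def)
      then obtain k where "length \<sigma> = n * k" "q * real k < real (blk_sum n g Y k)"
        unfolding deviates_init[OF n] dev by blast
      thus "\<exists>k\<ge>a * i. q * real k \<le> real (blk_sum n g Y k)"
        using *(2) n by (intro exI[of _ k]) (auto simp: mult.assoc)
    qed
    moreover have "{X. \<exists>k\<ge>a * i. q * real k \<le> real (blk_sum n g X k)} \<in> \<mu>.events"
    proof -
      have "{X \<in> space cantor. \<exists>k\<in>{a * i..}. q * real k \<le> real (blk_sum n g X k)} \<in> sets cantor"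
        unfolding blk_sum_def by measurable
      thus ?thesis by (simp add: sets_\<mu> Bex_def)
    qed
    ultimately show "measure \<mu> (\<Union>\<sigma>\<in>{\<sigma>. deviates n g b c (val \<sigma>) \<and> n * a * i \<le> length \<sigma>}. cyl \<sigma>) \<le> 1 / 2 ^ i"
      using \<mu>.finite_measure_mono a[of i] order.trans by blast
  qed
  hence "eventually (\<lambda>k. \<not> deviates n g b c (val (init X (n * k)))) sequentially"
    using n by (intro eventually_compose_filterlim[OF _ mult_nat_left_at_top]) auto
  thus ?thesis
  proof eventually_elim
    case (elim k)
    hence "\<not> q * real k < real (blk_sum n g X k)"
      unfolding deviates_init[OF n] dev by blast
    hence "real (blk_sum n g X k) \<le> q * real k" by simp
    also have "\<dots> \<le> x * real k" using q(3) by (intro mult_right_mono) auto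
    finally show ?case .
  qed
qed

text \<open>The upper bound for \<open>g\<close> and the upper bound for \<open>M - g\<close> enclose the averages of \<open>g\<close>. The
  function \<open>M - g\<close> is again a function into the naturals because \<open>M\<close> bounds \<open>g\<close> on all blocks.\<close>

lemma schnorr_block_law_of_large_numbers:
  assumes "computable_measure \<mu>" "schnorr_random \<mu> X"
  shows "(\<lambda>k. real (blk_sum n g X k) / real k) \<longlonglongrightarrow> (\<integral>\<sigma>. real (g \<sigma>) \<partial>P)"
proof -
  define E where "E = (\<integral>\<sigma>. real (g \<sigma>) \<partial>P)"
  obtain M where M: "\<And>\<sigma>. \<sigma> \<in> space P \<Longrightarrow> g \<sigma> \<le> M" using bounded_g[of g] by blast
  define h where "h = (\<lambda>\<sigma>. M - g \<sigma>)"
  have "(\<integral>\<sigma>. real (h \<sigma>) \<partial>P) = (\<integral>\<sigma>. real M - real (g \<sigma>) \<partial>P)"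
    using M by (intro Bochner_Integration.integral_cong) (auto simp: h_def of_nat_diff)
  hence Eh: "(\<integral>\<sigma>. real (h \<sigma>) \<partial>P) = real M - E"
    by (simp add: E_def P.prob_space)
  have sum_h: "real (blk_sum n h X k) = real M * real k - real (blk_sum n g X k)" for k
    using M by (simp add: blk_sum_def h_def space_P of_nat_diff sum_subtractf)
  show ?thesis
    unfolding E_def[symmetric]
  proof (rule order_tendstoI)
    fix y assume "E < y"
    then obtain x where x: "E < x" "x < y" using dense by blast
    show "eventually (\<lambda>k. real (blk_sum n g X k) / real k < y) sequentially"
      using eventually_blk_sum_le[OF assms x(1)[unfolded E_def]] eventually_gt_at_top[of 0]
    proof eventually_elim
      case (elim k)
      thus ?case using x(2) by (simp add: divide_le_eq order.strict_trans1[of _ x])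
    qed
  next
    fix y assume "y < E"
    then obtain x where x: "y < x" "x < E" using dense by blast
    have h: "(\<integral>\<sigma>. real (h \<sigma>) \<partial>P) < real M - x" using x(2) by (simp add: Eh)
    show "eventually (\<lambda>k. y < real (blk_sum n g X k) / real k) sequentially"
      using eventually_blk_sum_le[OF assms h] eventually_gt_at_top[of 0]
    proof eventually_elim
      case (elim k)
      have "x \<le> real (blk_sum n g X k) / real k"
        using elim by (simp add: sum_h le_divide_eq algebra_simps)
      thus ?case using x(1) by linarith
    qed
  qed
qed


section \<open>Output rates of block maps\<close>

text \<open>Each of the \<open>m div n\<close> complete blocks of a string of length \<open>m\<close> is distributed as \<open>P\<close>, and
  expectations add up.\<close>

lemma Avg_eq:
  assumes "\<And>X. length (\<phi> (init X m)) = blk_sum n g X (m div n)"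
  shows "Avg \<phi> \<mu> m = real (m div n) / real m * (\<integral>\<sigma>. real (g \<sigma>) \<partial>P)"
proof -
  interpret \<mu>: prob_space \<mu> by (rule prob_space_\<mu>)
  have intb: "integrable \<mu> (\<lambda>X. real (g (blk n X j)))" for j
  proof -
    obtain M where "\<And>\<sigma>. \<sigma> \<in> space P \<Longrightarrow> g \<sigma> \<le> M" using bounded_g[of g] by blast
    moreover have "(\<lambda>X. real (g (blk n X j))) \<in> borel_measurable \<mu>"
      unfolding measurable_cong_sets[OF sets_\<mu> refl] by (rule borel_measurable_blk)
    ultimately show ?thesis
      by (intro \<mu>.integrable_const_bound[of _ "real M"]) (auto simp: space_P)
  qed
  have blk: "(\<integral>X. real (g (blk n X j)) \<partial>\<mu>) = (\<integral>\<sigma>. real (g \<sigma>) \<partial>P)" for j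
  proof -
    have "(\<integral>X. real (g (blk n X j)) \<partial>\<mu>) = (\<integral>B. real (g (blk n (join_blocks n B) j)) \<partial>\<Omega>)"
      unfolding \<mu>_eq by (rule integral_distr[OF measurable_join borel_measurable_blk])
    also have "\<dots> = (\<integral>B. real (g (B j)) \<partial>\<Omega>)"
      by (intro Bochner_Integration.integral_cong) (auto simp: blk_sum_join)
    finally show ?thesis by (simp add: expectation_component)
  qed
  have "(\<Sum>\<sigma> | length \<sigma> = m. measure \<mu> (cyl \<sigma>) * real (length (\<phi> \<sigma>))) =
      (\<integral>X. (\<Sum>\<sigma> | length \<sigma> = m. indicator (cyl \<sigma>) X * real (length (\<phi> \<sigma>))) \<partial>\<mu>)"
    by (subst Bochner_Integration.integral_sum) (auto simp: sets_\<mu> \<mu>.emeasure_eq_measure)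
  also have "\<dots> = (\<integral>X. real (blk_sum n g X (m div n)) \<partial>\<mu>)"
  proof (intro Bochner_Integration.integral_cong refl)
    fix X
    have "(\<Sum>\<sigma> | length \<sigma> = m. indicator (cyl \<sigma>) X * real (length (\<phi> \<sigma>))) =
        (\<Sum>\<sigma>\<in>{init X m}. real (length (\<phi> \<sigma>)))"
      by (rule sum.mono_neutral_cong_right) (auto simp: finite_strings cyl_def)
    thus "(\<Sum>\<sigma> | length \<sigma> = m. indicator (cyl \<sigma>) X * real (length (\<phi> \<sigma>))) = real (blk_sum n g X (m div n))"
      by (simp add: assms)
  qed
  also have "\<dots> = real (m div n) * (\<integral>\<sigma>. real (g \<sigma>) \<partial>P)"
    unfolding blk_sum_def of_nat_sum by (subst Bochner_Integration.integral_sum) (auto simp: intb blk)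
  finally show ?thesis by (simp add: Avg_def)
qed

end

text \<open>An incomplete last block contributes nothing to the output.\<close>

lemma length_block_map:
  assumes "block_map n \<phi>" "1 \<le> n"
  shows "length (\<phi> (init X m)) = blk_sum n (\<lambda>\<sigma>. length (\<phi> \<sigma>)) X (m div n)"
proof -
  define k where "k = m div n"
  define \<tau> where "\<tau> = drop (n * k) (init X m)"
  have "n * k \<le> m" by (simp add: k_def)
  hence "init X m = init X (n * k) @ \<tau>"
    using append_take_drop_id[of "n * k" "init X m"] by (simp add: \<tau>_def min_def)
  also have "init X (n * k) = concat (map (blk n X) [0..<k])"
    by (rule concat_blk[symmetric])
  finally have "init X m = concat (map (blk n X) [0..<k]) @ \<tau>" .
  moreover have "length \<tau> < n"
    using assms(2) mod_less_divisor[of n m] by (simp add: \<tau>_def k_def minus_mult_div_eq_mod)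
  moreover have "\<forall>\<sigma>\<in>set (map (blk n X) [0..<k]). length \<sigma> = n" by auto
  ultimately have "\<phi> (init X m) = concat (map \<phi> (map (blk n X) [0..<k]))"
    using assms(1) unfolding block_map_def by metis
  thus ?thesis
    by (simp add: length_concat blk_sum_def k_def sum_list_distinct_conv_sum_set lessThan_atLeast0 comp_def)
qed

lemma div_ratio_tendsto:
  assumes "1 \<le> n"
  shows "(\<lambda>m. real (m div n) / real m) \<longlonglongrightarrow> 1 / real n"
proof (rule tendsto_sandwich)
  show "eventually (\<lambda>m. 1 / real n - 1 / real m \<le> real (m div n) / real m) sequentially"
    using eventually_gt_at_top[of 0]
  proof eventually_elim
    case (elim m)
    have "real m < real n * (real (m div n) + 1)"
      using assms dividend_less_div_times[of n m] by (simp add: algebra_simps flip: of_nat_mult of_nat_add)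
    hence "real m / real n < real (m div n) + 1" using assms by (simp add: divide_less_eq mult.commute)
    hence "(real m / real n - 1) / real m \<le> real (m div n) / real m"
      by (intro divide_right_mono) auto
    thus ?case using elim by (simp add: diff_divide_distrib)
  qed
  show "eventually (\<lambda>m. real (m div n) / real m \<le> 1 / real n) sequentially"
    using eventually_gt_at_top[of 0]
  proof eventually_elim
    case (elim m)
    have "real (m div n) \<le> real m / real n" 
      using assms div_times_less_eq_dividend[of m n]
      by (simp add: pos_le_divide_eq flip: of_nat_mult)
    thus ?case using elim by (simp add: field_simps)
  qed
  have "(\<lambda>m. 1 / real n - 1 / real m) \<longlonglongrightarrow> 1 / real n - 0"
    by (intro tendsto_diff tendsto_const lim_1_over_n)
  thus "(\<lambda>m. 1 / real n - 1 / real m) \<longlonglongrightarrow> 1 / real n" by simp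
qed simp

theorem theorem19:
  fixes n :: nat and \<mu> :: "(nat \<Rightarrow> bool) measure" and X :: "nat \<Rightarrow> bool"
  assumes "n \<ge> 1"
    and "bernoulli_measure n \<mu>"
    and "computable_measure \<mu>"
    and "positive_measure \<mu>"
    and "schnorr_random \<mu> X"
  shows "\<forall>\<phi> \<Phi>. nontrivial_block_map n \<phi> \<and> associated n \<phi> \<Phi> \<longrightarrow> OI \<Phi> X = Rate \<Phi> \<mu>"
proof (intro allI impI)
  fix \<phi> \<Phi>
  assume "nontrivial_block_map n \<phi> \<and> associated n \<phi> \<Phi>"
  hence \<phi>: "block_map n \<phi>" "canonical_generator \<Phi> = \<phi>"
    by (auto simp: associated_def canonical_generator_eq)
  obtain P where "prob_space P" "sets P = Pow {\<sigma> :: bool list. length \<sigma> = n}"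
    "\<mu> = distr (Pi\<^sub>M UNIV (\<lambda>_ :: nat. P)) cantor (join_blocks n)"
    using assms(2) unfolding bernoulli_measure_def by blast
  then interpret bernoulli_blocks P n \<mu>
    using assms(1) by (simp add: bernoulli_blocks_def bernoulli_blocks_axioms_def)
  define g where "g = (\<lambda>\<sigma>. length (\<phi> \<sigma>))"
  define E where "E = (\<integral>\<sigma>. real (g \<sigma>) \<partial>P)"
  have len: "length (\<phi> (init Y m)) = blk_sum n g Y (m div n)" for Y m
    using length_block_map[OF \<phi>(1) assms(1)] by (simp add: g_def)
  have "(\<lambda>m. Avg \<phi> \<mu> m) \<longlonglongrightarrow> 1 / real n * E"
    unfolding Avg_eq[of \<phi> _ g, OF len] E_def
    by (intro tendsto_mult tendsto_const div_ratio_tendsto assms(1))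
  hence Rate: "Rate \<Phi> \<mu> = ereal (1 / real n * E)"
    unfolding Rate_def \<phi>(2) by (intro lim_imp_Limsup) auto
  have "filterlim (\<lambda>m. m div n) sequentially sequentially"
    using assms(1) by (intro filterlim_at_top_div_const_nat) auto
  hence "(\<lambda>m. real (blk_sum n g X (m div n)) / real (m div n)) \<longlonglongrightarrow> E"
    unfolding E_def by (rule filterlim_compose[OF schnorr_block_law_of_large_numbers[OF assms(3,5)]])
  hence "(\<lambda>m. real (m div n) / real m * (real (blk_sum n g X (m div n)) / real (m div n))) \<longlonglongrightarrow> 1 / real n * E"
    by (intro tendsto_mult div_ratio_tendsto assms(1))
  moreover have "real (m div n) / real m * (real (blk_sum n g X (m div n)) / real (m div n)) =
      real (length (\<phi> (init X m))) / real m" for m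
    by (cases "m div n = 0") (auto simp: len blk_sum_def)
  ultimately have "(\<lambda>m. real (length (\<phi> (init X m))) / real m) \<longlonglongrightarrow> 1 / real n * E"
    by simp
  hence "OI \<Phi> X = ereal (1 / real n * E)"
    unfolding OI_def \<phi>(2) by (intro lim_imp_Limsup) auto
  thus "OI \<Phi> X = Rate \<Phi> \<mu>" using Rate by simp
qed

end
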